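(* Let $n\ge2$ be an integer, $N=2n$, $m_0=+1$ or $-1$, and $m_j=m_0$ for $1\le j\le N=2n$. Let $0\le\theta_0<2\pi$ and $0<a_1<a_2$ be constants, $C_1=\frac12(a_1^2+a_2^2)$, $C_2=\frac12(a_2^2-a_1^2)$, and $\theta_n^j=\frac{2(j-1)\pi}{n}+\theta_0$ for $1\le j\le n$. Consider the system $$\dot{\mathbf x}_j(t)=2m_j\sum_{k=1,k\ne j}^N m_k\frac{\mathbf x_j(t)-\mathbf x_k(t)}{|\mathbf x_j(t)-\mathbf x_k(t)|^2},\qquad 1\le j\le N,\quad t>0,$$ with initial data $$\mathbf x_j(0)=a_1(\cos\theta_n^j,\sin\theta_n^j)^T,\qquad \mathbf x_{n+j}(0)=a_2(\cos\theta_n^j,\sin\theta_n^j)^T,\qquad 1\le j\le n.$$ Then the solution can be given as $$\mathbf x_j(t)=\sqrt{\rho_1(t)}\,(\cos\theta_n^j,\sin\theta_n^j)^T,\qquad \mathbf x_{n+j}(t)=\sqrt{\rho_2(t)}\,(\cos\theta_n^j,\sin\theta_n^j)^T,\qquad 1\le j\le n,\ t\ge0,$$ where, when $n=2$, $$\rho_1(t)=C_1+6t-\sqrt{C_2^2+8C_1t+24t^2},\qquad \rho_2(t)=C_1+6t+\sqrt{C_2^2+8C_1t+24t^2},\qquad t\ge0;$$ and when $n\ge3$, $$\rho_1(t)\sim\alpha_1t,\qquad \rho_2(t)\sim\beta_1t,\qquad t\gg1,$$ with $\alpha_1$ and $\beta_1$ being two positive constants satisfying $$0<\alpha_1<\beta_1,\qquad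 \alpha_1+\beta_1=8n-4,\qquad \beta_1-\alpha_1=4n\,\frac{\beta_1^{n/2}+\alpha_1^{n/2}}{\beta_1^{n/2}-\alpha_1^{n/2}} .$$ Specifically, when $n\gg1$, $\alpha_1\approx2n-2$ and $\beta_1\approx6n-2$.
   Context: Here $\mathbf x_j(t)\in\mathbb R^2$ is the center of the $j$-th of $N$ quantized vortices and $m_j\in\{+1,-1\}$ is its winding number. The notation $f(t)\sim g(t)$, $t\gg1$, is the usual notation for asymptotic behaviour at large time. The symbol $\approx$ for $n\gg1$ denotes approximate equality for large $n$, with no quantitative error specified. *)

theory Defs
  imports "HOL-Analysis.Analysis" "HOL-Library.Landau_Symbols"
begin

definition vortex_velocity :: "nat \<Rightarrow> (nat \<Rightarrow> int) \<Rightarrow> (nat \<Rightarrow> real^2) \<Rightarrow> nat \<Rightarrow> real^2" where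
  "vortex_velocity N m p j =
     (2 * of_int (m j)) *\<^sub>R
       (\<Sum>k\<in>{1..N} - {j}. (of_int (m k) / (norm (p j - p k))\<^sup>2) *\<^sub>R (p j - p k))"

text \<open>The equations hold for \<open>t > 0\<close> only, so attainment of the initial data is expressed by
  continuity on \<open>[0, \<infinity>)\<close>. The vortex centers are required to stay distinct because the right-hand
  side of the system is undefined at a collision (in HOL the singular term would silently be 0).
  Only the indices \<open>1..N\<close> and the times \<open>t \<ge> 0\<close> matter.\<close>

definition vortex_solution ::
  "nat \<Rightarrow> (nat \<Rightarrow> int) \<Rightarrow> (nat \<Rightarrow> real^2) \<Rightarrow> (nat \<Rightarrow> real \<Rightarrow> real^2) \<Rightarrow> bool" where
  "vortex_solution N m p x \<longleftrightarrow>
     (\<forall>j\<in>{1..N}. x j 0 = p j \<and> continuous_on {0..} (x j)) \<and>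
     (\<forall>t\<ge>0. \<forall>j\<in>{1..N}. \<forall>k\<in>{1..N}. j \<noteq> k \<longrightarrow> x j t \<noteq> x k t) \<and>
     (\<forall>t>0. \<forall>j\<in>{1..N}.
        (x j has_vector_derivative vortex_velocity N m (\<lambda>k. x k t) j) (at t))"

definition ring_angle :: "nat \<Rightarrow> real \<Rightarrow> nat \<Rightarrow> real" where
  "ring_angle n \<theta>0 j = 2 * (real j - 1) * pi / real n + \<theta>0"

definition unit_vec :: "real \<Rightarrow> real^2" where
  "unit_vec \<theta> = vector [cos \<theta>, sin \<theta>]"

end

theory Submission
  imports Defs
begin

text \<open>Each ring is \<open>r W\<close>, where \<open>W\<close> is the set of solutions of \<open>w ^ n = u\<close> with \<open>|u| = 1\<close>. Summing
  \<open>1 / (z - w)\<close> over \<open>W\<close> shows that every vortex moves radially, with a speed depending only on the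
  two radii, so the symmetric configuration reduces the system to two equations for the squared
  radii \<open>\<rho>1 < \<rho>2\<close>. Uniqueness for the full system follows from Gronwall, since the kernel
  \<open>K u = u / |u|\<^sup>2\<close> satisfies \<open>|K u - K v| = |u - v| / (|u| |v|)\<close>.

  In the reduced system \<open>\<rho>1 + \<rho>2\<close> is affine in \<open>t\<close> with slope \<open>8 n - 4\<close>, and in a logarithmic time
  the ratio \<open>q = (\<rho>2 - \<rho>1) / (\<rho>1 + \<rho>2)\<close> solves a scalar autonomous equation whose right-hand side
  is strictly decreasing on \<open>(0, 1)\<close> and changes sign once. Hence \<open>q\<close> converges to this zero \<open>b\<close>,
  which gives \<open>\<alpha> = (4 n - 2) (1 - b)\<close> and \<open>\<beta> = (4 n - 2) (1 + b)\<close>; since \<open>b \<ge> 1 / 2\<close>, the error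
  in the approximations of \<open>\<alpha>\<close> and \<open>\<beta>\<close> decays geometrically in \<open>n\<close>.\<close>

section \<open>Interaction of two concentric rings\<close>

text \<open>The plane is identified with the complex numbers so that the sums over a ring become
  sums over complex roots, where algebra is available.\<close>

definition vec_of_complex :: "complex \<Rightarrow> real^2" where
  "vec_of_complex z = vector [Re z, Im z]"

lemma linear_vec_of_complex: "linear vec_of_complex"
  by (rule linearI) (simp_all add: vec_of_complex_def vec_eq_iff forall_2)

lemma norm_vec_of_complex: "norm (vec_of_complex z) = cmod z"
  by (simp add: vec_of_complex_def norm_vec_def L2_set_def UNIV_2 cmod_def)

lemma unit_vec_conv_cis: "unit_vec \<theta> = vec_of_complex (cis \<theta>)"
  by (simp add: unit_vec_def vec_of_complex_def)

text \<open>Since \<open>z * cnj z\<close> is the squared modulus, the interaction kernel is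
  inversion in the unit circle. At \<open>z = 0\<close> both sides vanish because
  \<open>inverse 0 = 0\<close>.\<close>

lemma kernel_vec_of_complex:
  "(1 / (norm (vec_of_complex z))\<^sup>2) *\<^sub>R vec_of_complex z = vec_of_complex (inverse (cnj z))"
proof -
  have "complex_of_real (1 / (cmod z)\<^sup>2) * z = inverse (cnj z)"
    by (cases "z = 0") (simp_all add: complex_norm_square field_simps del: of_real_power)
  then have "(1 / (cmod z)\<^sup>2) *\<^sub>R z = inverse (cnj z)"
    by (simp add: scaleR_conv_of_real)
  then show ?thesis
    using linear_cmul[OF linear_vec_of_complex, of "1 / (cmod z)\<^sup>2" z]
    by (simp add: norm_vec_of_complex)
qed

section \<open>Sums over the solutions of \<open>w ^ n = u\<close>\<close>

text \<open>Multiplication by a primitive \<open>n\<close>-th root of unity \<open>c\<close>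
  permutes the solutions and multiplies the sum by \<open>c ^ i\<close>, which differs from
  1.\<close>

lemma sum_power_nth_roots:
  fixes u :: complex
  assumes "0 < i" "i < n"
  shows "(\<Sum>w | w ^ n = u. w ^ i) = 0"
proof -
  define c where "c = cis (2 * pi / real n)"
  have c: "c \<noteq> 0" "c ^ n = 1"
    using assms by (simp_all add: c_def Complex.DeMoivre)
  have "c ^ i \<noteq> 1"
  proof
    assume "c ^ i = 1"
    then have "cis (real i * (2 * pi / real n)) = 1"
      by (simp only: c_def Complex.DeMoivre)
    then have "cis (2 * pi * real i / real n) = cis (2 * pi * real 0 / real n)"
      by (simp add: mult_ac)
    moreover have "inj_on (\<lambda>k. cis (2 * pi * real k / real n)) {..<n}"
      using Complex.bij_betw_roots_unity[of n] assms by (simp add: bij_betw_def)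
    ultimately have "i = 0" using assms by (elim inj_onD) auto
    with assms show False by simp
  qed
  moreover have "(\<Sum>w | w ^ n = u. w ^ i) = (\<Sum>w | w ^ n = u. (c * w) ^ i)"
    by (rule sum.reindex_bij_witness[of _ "\<lambda>w. c * w" "\<lambda>w. w / c"])
       (use c in \<open>auto simp: power_mult_distrib power_divide\<close>)
  then have "(\<Sum>w | w ^ n = u. w ^ i) = c ^ i * (\<Sum>w | w ^ n = u. w ^ i)"
    by (simp add: power_mult_distrib flip: sum_distrib_left)
  ultimately show ?thesis by simp
qed

text \<open>This is the logarithmic derivative of \<open>z ^ n - u\<close>. Factoring
  \<open>z - w\<close> out of \<open>z ^ n - w ^ n\<close> turns each summand into a polynomial in
  \<open>w\<close> over a common denominator, and after summation only the power
  \<open>w ^ 0\<close> survives.\<close>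

lemma sum_inverse_diff_nth_roots:
  fixes u z :: complex
  assumes n: "n > 0" and u: "u \<noteq> 0" and z: "z ^ n \<noteq> u"
  shows "(\<Sum>w | w ^ n = u. inverse (z - w)) = of_nat n * z ^ (n - 1) / (z ^ n - u)"
proof -
  have *: "inverse (z - w) = (\<Sum>i<n. z ^ (n - Suc i) * w ^ i) / (z ^ n - u)" if "w ^ n = u" for w
  proof -
    have "z ^ n - u = (z - w) * (\<Sum>i<n. z ^ (n - Suc i) * w ^ i)"
      using power_diff_sumr2[of w n z] that diff_power_eq_sum
      by (metis (no_types, lifting) minus_diff_eq mult_minus_left sum.cong mult.commute)
    moreover have "z - w \<noteq> 0" using z that by auto
    ultimately show ?thesis using z by (simp add: field_simps)
  qed
  have "(\<Sum>w | w ^ n = u. inverse (z - w))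
      = (\<Sum>w | w ^ n = u. (\<Sum>i<n. z ^ (n - Suc i) * w ^ i) / (z ^ n - u))"
    by (rule sum.cong) (use * in auto)
  also have "\<dots> = (\<Sum>i<n. z ^ (n - Suc i) * (\<Sum>w | w ^ n = u. w ^ i)) / (z ^ n - u)"
    by (simp add: sum_distrib_left sum_divide_distrib[symmetric] sum.swap[of _ _ "{w. w ^ n = u}"])
  also have "(\<Sum>i<n. z ^ (n - Suc i) * (\<Sum>w | w ^ n = u. w ^ i))
      = (\<Sum>i<n. if i = 0 then of_nat n * z ^ (n - 1) else 0)"
    by (rule sum.cong) (use n u in \<open>auto simp: sum_power_nth_roots card_nth_roots\<close>)
  also have "\<dots> = of_nat n * z ^ (n - 1)"
    using n by (simp add: sum.delta)
  finally show ?thesis .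
qed

text \<open>The involution \<open>w \<mapsto> w0\<^sup>2 / w\<close> pairs off the terms.\<close>
lemma sum_inverse_diff_other_nth_roots:
  fixes u w0 :: complex
  assumes n: "n > 0" and u: "u \<noteq> 0" and w0: "w0 ^ n = u"
  shows "(\<Sum>w\<in>{w. w ^ n = u} - {w0}. inverse (w0 - w)) = of_nat (n - 1) / (2 * w0)"
    (is "sum ?f ?A = _")
proof -
  have w0n: "w0 \<noteq> 0" using assms by (auto simp: power_0_left)
  have nz: "w \<noteq> 0" if "w \<in> ?A" for w using that n u by (auto simp: power_0_left)
  have fin: "finite {w::complex. w ^ n = u}" using n by (simp add: finite_nth_roots)
  have "sum ?f ?A = (\<Sum>w\<in>?A. ?f (w0\<^sup>2 / w))"
    by (rule sum.reindex_bij_witness[of _ "\<lambda>w. w0\<^sup>2 / w" "\<lambda>w. w0\<^sup>2 / w"])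
       (use nz w0n w0 u in \<open>auto simp: power_divide power_mult_distrib field_simps power2_eq_square\<close>)
  then have "2 * sum ?f ?A = (\<Sum>w\<in>?A. ?f w + ?f (w0\<^sup>2 / w))"
    by (simp add: sum.distrib)
  also have "\<dots> = (\<Sum>w\<in>?A. 1 / w0)"
  proof (rule sum.cong)
    fix w assume "w \<in> ?A"
    then have "w \<noteq> 0" "w0 - w \<noteq> 0" using nz by auto
    moreover have "w0 - w0\<^sup>2 / w = - (w0 * (w0 - w) / w)"
      using \<open>w \<noteq> 0\<close> by (simp add: field_simps power2_eq_square)
    ultimately show "?f w + ?f (w0\<^sup>2 / w) = 1 / w0"
      using w0n by (simp add: divide_simps)
  qed simp
  also have "\<dots> = of_nat (n - 1) / w0"
    using fin w0 card_nth_roots[OF u] n by simp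
  finally have "2 * sum ?f ?A / 2 = of_nat (n - 1) / w0 / 2"
    by (rule arg_cong)
  then show ?thesis by simp
qed

section \<open>From root sums to vortex velocities\<close>

text \<open>The ring is the set of \<open>n\<close>-th roots of unity rotated by
  \<open>\<theta>0\<close>. An injection from \<open>n\<close> indices into a set of
  \<open>n\<close> solutions is onto.\<close>

lemma bij_betw_cis_ring_angle:
  assumes "n > 0"
  shows "bij_betw (\<lambda>j. cis (ring_angle n \<theta>0 j)) {1..n} {w. w ^ n = cis (real n * \<theta>0)}"
proof -
  have eq: "cis (ring_angle n \<theta>0 j) = cis \<theta>0 * cis (2 * pi * real (j - 1) / real n)"
    if "j \<in> {1..n}" for j
    using that by (simp add: ring_angle_def cis_mult of_nat_diff mult_ac add_ac)
  have "inj_on (\<lambda>j. cis (ring_angle n \<theta>0 j)) {1..n}"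
  proof (rule inj_onI)
    fix j k assume jk: "j \<in> {1..n}" "k \<in> {1..n}"
      "cis (ring_angle n \<theta>0 j) = cis (ring_angle n \<theta>0 k)"
    then have "cis (2 * pi * real (j - 1) / real n) = cis (2 * pi * real (k - 1) / real n)"
      by (simp add: eq)
    moreover have "inj_on (\<lambda>k. cis (2 * pi * real k / real n)) {..<n}"
      using Complex.bij_betw_roots_unity[of n] assms by (simp add: bij_betw_def)
    ultimately have "j - 1 = k - 1"
      using jk(1,2) by (elim inj_onD) auto
    with jk(1,2) show "j = k" by auto
  qed
  moreover have "(\<lambda>j. cis (ring_angle n \<theta>0 j)) ` {1..n} \<subseteq> {w. w ^ n = cis (real n * \<theta>0)}"
  proof clarify
    fix j assume "j \<in> {1..n}"
    have "cis (2 * pi * real (j - 1) / real n) ^ n = 1"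
      using bspec[OF bij_betwE[OF Complex.bij_betw_roots_unity[OF assms]], of "j - 1"]
        \<open>j \<in> {1..n}\<close> by force
    with \<open>j \<in> {1..n}\<close> show "cis (ring_angle n \<theta>0 j) ^ n = cis (real n * \<theta>0)"
      unfolding eq[OF \<open>j \<in> {1..n}\<close>] by (simp add: power_mult_distrib Complex.DeMoivre)
  qed
  moreover have "card {w. w ^ n = cis (real n * \<theta>0)} = n"
    using assms by (simp add: card_nth_roots)
  ultimately show ?thesis
    using assms by (simp add: bij_betw_def card_image card_subset_eq finite_nth_roots)
qed

text \<open>Signed radial velocity of a vortex on the ring of radius \<open>r\<close> when the other
  ring has radius \<open>s\<close>. The first summand comes from its own ring, the second from the
  other one; the factor 2 of the vortex law is included.\<close>

definition ring_speed :: "nat \<Rightarrow> real \<Rightarrow> real \<Rightarrow> real" where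
  "ring_speed n r s = real (n - 1) / r + 2 * real n * r ^ (n - 1) / (r ^ n - s ^ n)"

text \<open>In complex form both sums are conjugates of root sums, and each root sum is a real
  multiple of \<open>1 / w j\<close>. Conjugation turns this into a real multiple of
  \<open>w j\<close>, so the velocity is radial.\<close>

lemma ring_interaction:
  fixes \<theta>0 :: real
  assumes j: "j \<in> {1..n}" and r: "0 < r" and s: "0 < s" and rs: "r \<noteq> s"
  defines "v \<equiv> \<lambda>k. unit_vec (ring_angle n \<theta>0 k)"
  shows "2 *\<^sub>R ((\<Sum>k\<in>{1..n}-{j}. (1 / (norm (r *\<^sub>R v j - r *\<^sub>R v k))\<^sup>2) *\<^sub>R (r *\<^sub>R v j - r *\<^sub>R v k))
       + (\<Sum>k\<in>{1..n}. (1 / (norm (r *\<^sub>R v j - s *\<^sub>R v k))\<^sup>2) *\<^sub>R (r *\<^sub>R v j - s *\<^sub>R v k)))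
       = ring_speed n r s *\<^sub>R v j" (is "2 *\<^sub>R (?S1 + ?S2) = _")
proof -
  have n: "n > 0" using j by simp
  define w where "w = (\<lambda>k. cis (ring_angle n \<theta>0 k))"
  define u where "u = cis (real n * \<theta>0)"
  \<comment> \<open>Dividing by \<open>s\<close> moves the other ring to the unit circle, where its
    points are exactly the solutions of \<open>w ^ n = u\<close>.\<close>
  define z where "z = complex_of_real (r / s) * w j"
  have v: "a *\<^sub>R v j - b *\<^sub>R v k = vec_of_complex (of_real a * w j - of_real b * w k)" for a b k
    by (simp add: v_def w_def unit_vec_conv_cis linear_diff[OF linear_vec_of_complex]
        linear_cmul[OF linear_vec_of_complex] flip: scaleR_conv_of_real)
  have bij: "bij_betw w {1..n} {w. w ^ n = u}"
    unfolding w_def u_def using n by (rule bij_betw_cis_ring_angle)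
  have wj: "w j ^ n = u" using bij j by (auto simp: bij_betw_def)
  have wj0: "w j \<noteq> 0" and u0: "u \<noteq> 0" by (simp_all add: w_def u_def)
  \<comment> \<open>This holds because \<open>w j\<close> has modulus 1.\<close>
  have cnj: "cnj (1 / w j) = w j"
    by (simp add: w_def cis_cnj divide_inverse)
  have zn: "z ^ n - u = of_real ((r ^ n - s ^ n) / s ^ n) * u"
    using s by (simp add: z_def power_mult_distrib wj power_divide field_simps)
  have rsn: "r ^ n \<noteq> s ^ n" using rs r s n by (simp add: power_eq_iff_eq_base)
  have zu: "z ^ n \<noteq> u"
    using zn rsn u0 s by (auto simp del: of_real_diff of_real_divide of_real_power)
  have "bij_betw w ({1..n} - {j}) ({w. w ^ n = u} - {w j})"
    using bij j by (intro bij_betw_DiffI) (auto simp: bij_betw_def)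
  from sum.reindex_bij_betw[OF this, of "\<lambda>x. inverse (w j - x)"]
  have "(\<Sum>k\<in>{1..n}-{j}. inverse (w j - w k)) = of_nat (n - 1) / (2 * w j)"
    by (simp only: sum_inverse_diff_other_nth_roots[OF n u0 wj])
  moreover have "inverse (of_real r * w j - of_real r * w k) = of_real (1 / r) * inverse (w j - w k)" for k
    by (metis inverse_mult_distrib inverse_eq_divide of_real_inverse right_diff_distrib)
  ultimately have "(\<Sum>k\<in>{1..n}-{j}. inverse (of_real r * w j - of_real r * w k))
      = of_real (real (n - 1) / (2 * r)) * (1 / w j)"
    using r wj0 by (simp flip: sum_distrib_left sum_divide_distrib)
  then have "(\<Sum>k\<in>{1..n}-{j}. inverse (cnj (of_real r * w j - of_real r * w k)))
      = of_real (real (n - 1) / (2 * r)) * cnj (1 / w j)"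
    by (metis (no_types, lifting) cnj_sum complex_cnj_complex_of_real complex_cnj_inverse
        complex_cnj_mult sum.cong)
  then have S1: "?S1 = vec_of_complex (of_real (real (n - 1) / (2 * r)) * w j)"
    unfolding cnj by (simp only: v kernel_vec_of_complex linear_sum[OF linear_vec_of_complex, symmetric])
  from sum.reindex_bij_betw[OF bij, of "\<lambda>x. inverse (z - x)"]
  have "(\<Sum>k\<in>{1..n}. inverse (z - w k)) = of_nat n * z ^ (n - 1) / (z ^ n - u)"
    by (simp only: sum_inverse_diff_nth_roots[OF n u0 zu])
  moreover have "inverse (of_real r * w j - of_real s * w k) = of_real (1 / s) * inverse (z - w k)" for k
  proof -
    have "of_real r * w j - of_real s * w k = of_real s * (z - w k)"
      using s by (simp add: z_def field_simps)
    then show ?thesis by (simp add: divide_inverse)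
  qed
  ultimately have "(\<Sum>k\<in>{1..n}. inverse (of_real r * w j - of_real s * w k))
      = of_real (1 / s) * (of_nat n * z ^ (n - 1) / (z ^ n - u))"
    by (simp flip: sum_distrib_left sum_divide_distrib)
  \<comment> \<open>Both \<open>z ^ (n - 1)\<close> and \<open>z ^ n - u\<close> carry the factor
    \<open>u\<close>; it cancels and leaves a real number times \<open>1 / w j\<close>.\<close>
  also have "\<dots> = of_real (real n * r ^ (n - 1) / (r ^ n - s ^ n)) * (1 / w j)"
  proof -
    have "w j ^ (n - 1) = u / w j"
      using wj wj0 n by (metis power_diff power_one_right One_nat_def Suc_leI)
    moreover have "s ^ n = s * s ^ (n - 1)"
      using n by (cases n) auto
    moreover have "complex_of_real (r ^ n - s ^ n) \<noteq> 0"
      using rsn by (simp del: of_real_diff of_real_power)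
    ultimately show ?thesis
      using s wj0 u0 unfolding zn
      by (simp add: z_def power_mult_distrib power_divide field_simps del: of_real_diff)
  qed
  finally have "(\<Sum>k\<in>{1..n}. inverse (cnj (of_real r * w j - of_real s * w k)))
      = of_real (real n * r ^ (n - 1) / (r ^ n - s ^ n)) * cnj (1 / w j)"
    by (metis (no_types, lifting) cnj_sum complex_cnj_complex_of_real complex_cnj_inverse
        complex_cnj_mult sum.cong)
  then have S2: "?S2 = vec_of_complex (of_real (real n * r ^ (n - 1) / (r ^ n - s ^ n)) * w j)"
    unfolding cnj by (simp only: v kernel_vec_of_complex linear_sum[OF linear_vec_of_complex, symmetric])
  have vec: "vec_of_complex (of_real c * w j) = c *\<^sub>R v j" for c
    by (simp add: v_def w_def unit_vec_conv_cis linear_cmul[OF linear_vec_of_complex]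
        flip: scaleR_conv_of_real)
  show ?thesis
    unfolding S1 S2 vec ring_speed_def by (simp add: scaleR_add_left scaleR_add_right mult.assoc)
qed

text \<open>Equal winding numbers have product 1, so the sign \<open>m0\<close> drops out. The other
  indices split into the rest of the vortex's own ring and the whole other ring; the outer ring is
  the same case with the radii exchanged.\<close>

lemma vortex_velocity_two_rings:
  fixes p :: "nat \<Rightarrow> real^2"
  assumes m: "\<forall>j\<in>{1..2*n}. m j = m0" "m0 \<in> {1, -1}"
    and r: "0 < r" "0 < s" "r \<noteq> s"
    and p: "\<forall>j\<in>{1..n}. p j = r *\<^sub>R unit_vec (ring_angle n \<theta>0 j) \<and>
              p (n + j) = s *\<^sub>R unit_vec (ring_angle n \<theta>0 j)"
    and j: "j \<in> {1..n}"
  shows "vortex_velocity (2 * n) m p j = ring_speed n r s *\<^sub>R unit_vec (ring_angle n \<theta>0 j)"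
    and "vortex_velocity (2 * n) m p (n + j) = ring_speed n s r *\<^sub>R unit_vec (ring_angle n \<theta>0 j)"
proof -
  let ?K = "\<lambda>i k. (1 / (norm (p i - p k))\<^sup>2) *\<^sub>R (p i - p k)"
  have vel: "vortex_velocity (2 * n) m p i = 2 *\<^sub>R (\<Sum>k\<in>{1..2*n} - {i}. ?K i k)" if "i \<in> {1..2*n}" for i
  proof -
    have "vortex_velocity (2 * n) m p i
        = (2 * of_int m0) *\<^sub>R (\<Sum>k\<in>{1..2*n} - {i}. (of_int m0 / (norm (p i - p k))\<^sup>2) *\<^sub>R (p i - p k))"
      using that m by (simp add: vortex_velocity_def)
    also have "\<dots> = (2 * of_int (m0 * m0)) *\<^sub>R (\<Sum>k\<in>{1..2*n} - {i}. ?K i k)"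
      by (simp add: scaleR_sum_right mult.assoc)
    also have "m0 * m0 = 1" using m by auto
    finally show ?thesis by simp
  qed
  have split1: "{1..2*n} - {j} = ({1..n} - {j}) \<union> (+) n ` {1..n}"
    and split2: "{1..2*n} - {n + j} = (+) n ` ({1..n} - {j}) \<union> {1..n}"
  proof -
    have *: "{1..2*n} = {1..n} \<union> (+) n ` {1..n}"
      by (simp add: image_add_atLeastAtMost) auto
    have "(+) n ` ({1..n} - {j}) = (+) n ` {1..n} - {n + j}"
      by (subst image_set_diff) auto
    with j show "{1..2*n} - {j} = ({1..n} - {j}) \<union> (+) n ` {1..n}"
      "{1..2*n} - {n + j} = (+) n ` ({1..n} - {j}) \<union> {1..n}" unfolding * by auto
  qed
  have "(\<Sum>k\<in>{1..2*n} - {j}. ?K j k) = (\<Sum>k\<in>{1..n} - {j}. ?K j k) + (\<Sum>k\<in>{1..n}. ?K j (n + k))"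
    unfolding split1 by (subst sum.union_disjoint) (auto simp: sum.reindex simp del: image_add_atLeastAtMost)
  with vel[of j] j ring_interaction[OF j r, of \<theta>0] p
  show "vortex_velocity (2 * n) m p j = ring_speed n r s *\<^sub>R unit_vec (ring_angle n \<theta>0 j)"
    by simp
  have "(\<Sum>k\<in>{1..2*n} - {n + j}. ?K (n + j) k)
      = (\<Sum>k\<in>{1..n} - {j}. ?K (n + j) (n + k)) + (\<Sum>k\<in>{1..n}. ?K (n + j) k)"
    unfolding split2 by (subst sum.union_disjoint) (auto simp: sum.reindex simp del: image_add_atLeastAtMost)
  with vel[of "n + j"] j ring_interaction[OF j r(2,1) r(3)[symmetric], of \<theta>0] p
  show "vortex_velocity (2 * n) m p (n + j) = ring_speed n s r *\<^sub>R unit_vec (ring_angle n \<theta>0 j)"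
    by simp
qed

section \<open>Uniqueness\<close>

text \<open>Squaring and expanding the inner products gives the same expression on both sides. The
  identity makes the kernel Lipschitz away from the origin.\<close>

lemma norm_inversion_diff:
  fixes u v :: "'a::real_inner"
  assumes "u \<noteq> 0" "v \<noteq> 0"
  shows "norm ((1 / (norm u)\<^sup>2) *\<^sub>R u - (1 / (norm v)\<^sup>2) *\<^sub>R v) = norm (u - v) / (norm u * norm v)"
proof -
  have "(norm ((1 / (norm u)\<^sup>2) *\<^sub>R u - (1 / (norm v)\<^sup>2) *\<^sub>R v))\<^sup>2
      = (norm (u - v) / (norm u * norm v))\<^sup>2"
    using assms unfolding power_divide power_mult_distrib power2_norm_eq_inner
    by (simp add: inner_diff inner_commute divide_simps)
  then show ?thesis
    by (simp add: power2_eq_iff_nonneg)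
qed

text \<open>The product of \<open>E\<close> with \<open>exp (- L * t)\<close> is nonincreasing and
  starts at 0. The derivative is required only inside the interval, since the vortex equations hold
  only for positive times.\<close>

lemma gronwall_zero:
  fixes E :: "real \<Rightarrow> real"
  assumes "0 \<le> T" "continuous_on {0..T} E" "E 0 = 0"
    and E: "\<And>t. 0 < t \<Longrightarrow> t < T \<Longrightarrow> \<exists>D. (E has_real_derivative D) (at t) \<and> D \<le> L * E t"
  shows "E T \<le> 0"
proof -
  let ?G = "\<lambda>t. E t * exp (- L * t)"
  have "?G T \<le> ?G 0"
  proof (rule DERIV_nonpos_imp_decreasing_open[of 0 T ?G])
    fix t assume "0 < t" "t < T"
    then obtain D where D: "(E has_real_derivative D) (at t)" "D \<le> L * E t"
      using E by blast
    have "(?G has_real_derivative (D - L * E t) * exp (- L * t)) (at t)"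
      by (auto intro!: derivative_eq_intros D(1) simp: algebra_simps)
    moreover have "(D - L * E t) * exp (- L * t) \<le> 0"
      using D(2) by (simp add: mult_nonpos_nonneg)
    ultimately show "\<exists>y. (?G has_real_derivative y) (at t) \<and> y \<le> 0" by blast
  qed (use assms in \<open>auto intro!: continuous_intros\<close>)
  then show ?thesis using \<open>E 0 = 0\<close> by (simp add: mult_le_0_iff)
qed

lemma vortex_solution_continuous_on:
  assumes "vortex_solution N m p x" "i \<in> {1..N}"
  shows "continuous_on {0..T} (x i)"
  by (rule continuous_on_subset[of "{0..}"]) (use assms in \<open>auto simp: vortex_solution_def\<close>)

lemma finite_positive_lower_bound:
  fixes f :: "'a \<Rightarrow> real"
  assumes "finite A" "\<forall>i\<in>A. 0 < f i"
  shows "\<exists>e>0. \<forall>i\<in>A. e \<le> f i"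
proof (intro exI conjI ballI)
  \<comment> \<open>Inserting 1 gives the minimum a value for empty \<open>A\<close> as
    well.\<close>
  show "0 < Min (insert 1 (f ` A))"
    using assms by (subst Min_gr_iff) auto
  show "Min (insert 1 (f ` A)) \<le> f i" if "i \<in> A" for i
    using assms that by (intro Min_le) auto
qed

text \<open>Each mutual distance is continuous and positive on the compact interval, hence attains a
  positive minimum, and there are finitely many pairs. This keeps a solution in a region where the
  velocity field is Lipschitz.\<close>

lemma vortex_solution_separation:
  assumes "vortex_solution N m p x"
  obtains d where "0 < d"
    "\<And>t j k. \<lbrakk>0 \<le> t; t \<le> T; j \<in> {1..N}; k \<in> {1..N}; j \<noteq> k\<rbrakk> \<Longrightarrow> d \<le> norm (x j t - x k t)"
proof -
  let ?I = "{(j, k). j \<in> {1..N} \<and> k \<in> {1..N} \<and> j \<noteq> k}"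
  have "\<exists>d>0. \<forall>t\<in>{0..T}. d \<le> norm (x j t - x k t)" if "(j, k) \<in> ?I" for j k
  proof (cases "T < 0")
    case False
    have "continuous_on {0..T} (x i)" if "i \<in> {1..N}" for i
      using assms that by (rule vortex_solution_continuous_on)
    then have "continuous_on {0..T} (\<lambda>t. norm (x j t - x k t))"
      using that by (auto intro!: continuous_intros)
    then have "\<exists>s\<in>{0..T}. \<forall>t\<in>{0..T}. norm (x j s - x k s) \<le> norm (x j t - x k t)"
      using False by (intro continuous_attains_inf) auto
    then obtain s where s: "s \<in> {0..T}" "\<forall>t\<in>{0..T}. norm (x j s - x k s) \<le> norm (x j t - x k t)"
      by blast
    moreover have "x j s \<noteq> x k s"
      using s(1) that assms by (auto simp: vortex_solution_def)
    ultimately show ?thesis by (intro exI[of _ "norm (x j s - x k s)"]) auto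
  qed (auto intro: exI[of _ 1])
  then have "\<forall>i\<in>?I. \<exists>d. 0 < d \<and> (\<forall>t\<in>{0..T}. d \<le> norm (x (fst i) t - x (snd i) t))"
    by auto
  from bchoice[OF this] obtain d where
    d: "\<forall>i\<in>?I. 0 < d i \<and> (\<forall>t\<in>{0..T}. d i \<le> norm (x (fst i) t - x (snd i) t))"
    by (elim exE)
  have "finite ?I"
    by (rule finite_subset[of _ "{1..N} \<times> {1..N}"]) auto
  then obtain e where e: "0 < e" "\<forall>i\<in>?I. e \<le> d i"
    using finite_positive_lower_bound[of ?I d] d by auto
  show thesis
  proof (rule that[OF e(1)])
    fix t j k assume *: "0 \<le> t" "t \<le> T" "j \<in> {1..N}" "k \<in> {1..N}" "j \<noteq> k"
    then have jk: "(j, k) \<in> ?I" by simp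
    have "e \<le> d (j, k)" by (rule bspec[OF e(2) jk])
    also have "\<dots> \<le> norm (x j t - x k t)"
      using bspec[OF d jk] * by simp
    finally show "e \<le> norm (x j t - x k t)" .
  qed
qed

text \<open>By \<open>norm_inversion_diff\<close> each kernel difference has a denominator of at
  least the square of \<open>d\<close>, and its numerator is at most the sum of two
  displacements.\<close>

lemma vortex_velocity_diff_le:
  assumes M: "\<And>k. k \<in> {1..N} \<Longrightarrow> \<bar>real_of_int (m k)\<bar> \<le> M"
    and d: "0 < d"
    and p: "\<And>k. k \<in> {1..N} - {j} \<Longrightarrow> d \<le> norm (p j - p k)"
    and q: "\<And>k. k \<in> {1..N} - {j} \<Longrightarrow> d \<le> norm (q j - q k)"
    and j: "j \<in> {1..N}"
  shows "norm (vortex_velocity N m p j - vortex_velocity N m q j)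
      \<le> 2 * M\<^sup>2 / d\<^sup>2 * (\<Sum>k\<in>{1..N} - {j}. norm (p j - q j) + norm (p k - q k))"
proof -
  let ?K = "\<lambda>p k. (1 / (norm (p j - p k))\<^sup>2) *\<^sub>R (p j - p k)"
  have M0: "0 \<le> M" using M[OF j] by linarith
  have K: "norm (?K p k - ?K q k) \<le> (norm (p j - q j) + norm (p k - q k)) / d\<^sup>2"
    if k: "k \<in> {1..N} - {j}" for k
  proof -
    have pq: "d \<le> norm (p j - p k)" "d \<le> norm (q j - q k)"
      using p q k by auto
    then have "p j - p k \<noteq> 0" "q j - q k \<noteq> 0" using d by auto
    then have "norm (?K p k - ?K q k)
        = norm ((p j - p k) - (q j - q k)) / (norm (p j - p k) * norm (q j - q k))"
      by (rule norm_inversion_diff)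
    also have "\<dots> \<le> (norm (p j - q j) + norm (p k - q k)) / (d * d)"
    proof (rule frac_le)
      have "(p j - p k) - (q j - q k) = (p j - q j) - (p k - q k)" by simp
      then show "norm ((p j - p k) - (q j - q k)) \<le> norm (p j - q j) + norm (p k - q k)"
        by (metis norm_triangle_ineq4)
      show "d * d \<le> norm (p j - p k) * norm (q j - q k)"
        using pq d by (intro mult_mono) auto
    qed (use d in auto)
    finally show ?thesis by (simp add: power2_eq_square)
  qed
  have "vortex_velocity N m p j - vortex_velocity N m q j
      = (2 * of_int (m j)) *\<^sub>R (\<Sum>k\<in>{1..N} - {j}. of_int (m k) *\<^sub>R (?K p k - ?K q k))"
    by (simp add: vortex_velocity_def sum_subtractf scaleR_diff_right)
  also have "norm \<dots> \<le> (2 * M) * (\<Sum>k\<in>{1..N} - {j}. M * ((norm (p j - q j) + norm (p k - q k)) / d\<^sup>2))"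
    unfolding norm_scaleR
  proof (intro mult_mono)
    show "norm (\<Sum>k\<in>{1..N} - {j}. of_int (m k) *\<^sub>R (?K p k - ?K q k))
        \<le> (\<Sum>k\<in>{1..N} - {j}. M * ((norm (p j - q j) + norm (p k - q k)) / d\<^sup>2))"
      by (rule sum_norm_le, unfold norm_scaleR, rule mult_mono) (use M K M0 in auto)
  qed (use M[OF j] M0 in auto)
  also have "\<dots> = 2 * M\<^sup>2 / d\<^sup>2 * (\<Sum>k\<in>{1..N} - {j}. norm (p j - q j) + norm (p k - q k))"
    by (simp add: sum_distrib_left power2_eq_square mult_ac)
  finally show ?thesis .
qed

lemma has_real_derivative_norm_power2:
  fixes f :: "real \<Rightarrow> 'a::real_inner"
  assumes "(f has_vector_derivative f') (at t)"
  shows "((\<lambda>t. (norm (f t))\<^sup>2) has_real_derivative 2 * (f t \<bullet> f')) (at t)"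
proof -
  have "(f has_derivative (\<lambda>h. h *\<^sub>R f')) (at t)"
    using assms by (simp add: has_vector_derivative_def)
  from has_derivative_inner[OF this this] show ?thesis
    unfolding power2_norm_eq_inner has_field_derivative_def
    by (rule has_derivative_eq_rhs) (auto simp: inner_commute)
qed

text \<open>The sum \<open>E\<close> of the squared distances between corresponding vortices
  vanishes at time 0 and satisfies a linear differential inequality on \<open>[0, T]\<close>, with a
  constant obtained from the common separation \<open>d\<close>.\<close>

lemma vortex_solution_unique:
  assumes x: "vortex_solution N m p x" and y: "vortex_solution N m p y"
    and j: "j \<in> {1..N}" and T: "0 \<le> T"
  shows "x j T = y j T"
proof -
  obtain d1 where d1: "0 < d1"
    "\<And>t j k. \<lbrakk>0 \<le> t; t \<le> T; j \<in> {1..N}; k \<in> {1..N}; j \<noteq> k\<rbrakk> \<Longrightarrow> d1 \<le> norm (x j t - x k t)"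
    using vortex_solution_separation[OF x] by blast
  obtain d2 where d2: "0 < d2"
    "\<And>t j k. \<lbrakk>0 \<le> t; t \<le> T; j \<in> {1..N}; k \<in> {1..N}; j \<noteq> k\<rbrakk> \<Longrightarrow> d2 \<le> norm (y j t - y k t)"
    using vortex_solution_separation[OF y] by blast
  define d where "d = min d1 d2"
  define M where "M = (\<Sum>k\<in>{1..N}. \<bar>real_of_int (m k)\<bar>)"
  define E where "E = (\<lambda>t. \<Sum>j\<in>{1..N}. (norm (x j t - y j t))\<^sup>2)"
  define v where "v = (\<lambda>j t. vortex_velocity N m (\<lambda>k. x k t) j - vortex_velocity N m (\<lambda>k. y k t) j)"
  define C where "C = 2 * M\<^sup>2 / d\<^sup>2"
  have d: "0 < d" using d1 d2 by (simp add: d_def)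
  have C: "0 \<le> C" by (simp add: C_def)
  have M: "\<bar>real_of_int (m k)\<bar> \<le> M" if "k \<in> {1..N}" for k
    unfolding M_def using that by (intro member_le_sum) auto
  have "E T \<le> 0"
  \<comment> \<open>The outer 2 comes from differentiating a square, \<open>C\<close> is the
    Lipschitz factor, and each index \<open>k\<close> contributes at most
    \<open>2 * E t\<close>.\<close>
  proof (rule gronwall_zero[OF T, where L = "\<Sum>j\<in>{1..N}. 2 * (C * (\<Sum>k\<in>{1..N} - {j}. 2))"])
    have "continuous_on {0..T} (x i)" "continuous_on {0..T} (y i)" if "i \<in> {1..N}" for i
      using x y that by (auto intro: vortex_solution_continuous_on)
    then show "continuous_on {0..T} E"
      unfolding E_def by (auto intro!: continuous_intros)
    show "E 0 = 0" using x y by (simp add: E_def vortex_solution_def)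
    fix t assume t: "0 < t" "t < T"
    have "((\<lambda>t. x j t - y j t) has_vector_derivative v j t) (at t)" if "j \<in> {1..N}" for j
      unfolding v_def using x y that t
      by (intro has_vector_derivative_diff) (auto simp: vortex_solution_def)
    then have "((\<lambda>t. (norm (x j t - y j t))\<^sup>2) has_real_derivative 2 * ((x j t - y j t) \<bullet> v j t)) (at t)"
      if "j \<in> {1..N}" for j
      using that by (auto intro: has_real_derivative_norm_power2)
    then have "(E has_real_derivative (\<Sum>j\<in>{1..N}. 2 * ((x j t - y j t) \<bullet> v j t))) (at t)"
      unfolding E_def by (intro DERIV_sum) auto
    moreover have "(\<Sum>j\<in>{1..N}. 2 * ((x j t - y j t) \<bullet> v j t))
        \<le> (\<Sum>j\<in>{1..N}. 2 * (C * (\<Sum>k\<in>{1..N} - {j}. 2)) * E t)"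
    proof (rule sum_mono)
      fix j assume j: "j \<in> {1..N}"
      let ?e = "\<lambda>k. norm (x k t - y k t)"
      have sq: "(?e k)\<^sup>2 \<le> E t" if "k \<in> {1..N}" for k
        unfolding E_def using that by (intro member_le_sum) auto
      have e: "?e j * (?e j + ?e k) \<le> 2 * E t" if "k \<in> {1..N} - {j}" for k
      proof -
        have "2 * (?e j * ?e k) \<le> (?e j)\<^sup>2 + (?e k)\<^sup>2"
          using sum_squares_bound[of "?e j" "?e k"] by simp
        moreover have "?e j * (?e j + ?e k) = (?e j)\<^sup>2 + ?e j * ?e k"
          by (simp add: algebra_simps power2_eq_square)
        ultimately show ?thesis
          using sq[OF j] sq[of k] that by (simp add: algebra_simps)
      qed
      have "(x j t - y j t) \<bullet> v j t \<le> ?e j * norm (v j t)"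
        by (rule norm_cauchy_schwarz)
      also have "\<dots> \<le> ?e j * (C * (\<Sum>k\<in>{1..N} - {j}. ?e j + ?e k))"
        unfolding v_def C_def
      proof (rule mult_left_mono, rule vortex_velocity_diff_le[OF _ d _ _ j])
        fix k assume "k \<in> {1..N} - {j}"
        with d1(2)[of t j k] d2(2)[of t j k] t j
        show "d \<le> norm (x j t - x k t)" "d \<le> norm (y j t - y k t)"
          by (auto simp: d_def)
      qed (use M in auto)
      also have "?e j * (C * (\<Sum>k\<in>{1..N} - {j}. ?e j + ?e k))
          = C * (\<Sum>k\<in>{1..N} - {j}. ?e j * (?e j + ?e k))"
        by (simp add: sum_distrib_left mult_ac)
      also have "\<dots> \<le> C * (\<Sum>k\<in>{1..N} - {j}. 2 * E t)"
        using C e by (intro mult_left_mono sum_mono) auto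
      also have "\<dots> = C * (\<Sum>k\<in>{1..N} - {j}. 2) * E t" by simp
      finally show "2 * ((x j t - y j t) \<bullet> v j t) \<le> 2 * (C * (\<Sum>k\<in>{1..N} - {j}. 2)) * E t"
        by (simp add: mult_ac)
    qed
    ultimately show "\<exists>D. (E has_real_derivative D) (at t)
        \<and> D \<le> (\<Sum>j\<in>{1..N}. 2 * (C * (\<Sum>k\<in>{1..N} - {j}. 2))) * E t"
      unfolding sum_distrib_right by blast
  qed
  moreover have "(norm (x j T - y j T))\<^sup>2 \<le> E T"
    unfolding E_def using j by (intro member_le_sum) auto
  ultimately have "(norm (x j T - y j T))\<^sup>2 \<le> 0" by linarith
  then show ?thesis by simp
qed

section \<open>Scalar flows converging to an equilibrium\<close>

text \<open>Near \<open>b\<close> the difference quotient of \<open>F\<close> stays above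
  \<open>D - 1\<close>; on the remaining compact part \<open>F\<close> is bounded and the distance
  to \<open>b\<close> is bounded below.\<close>

lemma bound_by_distance_to_zero:
  fixes F :: "real \<Rightarrow> real"
  assumes "c < b" and cont: "continuous_on {c..<b} F" and "F b = 0"
    and der: "(F has_real_derivative D) (at b)"
  obtains L where "\<And>s. s \<in> {c..<b} \<Longrightarrow> F s \<le> L * (b - s)"
proof -
  have "((\<lambda>s. (F s - F b) / (s - b)) \<longlongrightarrow> D) (at_left b)"
    using der by (simp add: has_field_derivative_iff filterlim_at_split)
  then have "eventually (\<lambda>s. (F s - F b) / (s - b) > D - 1) (at_left b)"
    by (rule order_tendstoD) simp
  then have "\<exists>b'<b. \<forall>s>b'. s < b \<longrightarrow> F s / (s - b) > D - 1"
    using \<open>F b = 0\<close> by (simp add: eventually_at_left_field)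
  then obtain b' where b': "b' < b" "\<And>s. b' < s \<Longrightarrow> s < b \<Longrightarrow> F s / (s - b) > D - 1"
    by blast
  have "continuous_on {c..b'} F"
    by (rule continuous_on_subset[OF cont]) (use b'(1) in auto)
  then have "compact (F ` {c..b'})"
    by (rule compact_continuous_image) simp
  then have "bounded (F ` {c..b'})"
    by (rule compact_imp_bounded)
  then obtain M where M: "\<forall>y\<in>F ` {c..b'}. norm y \<le> M"
    unfolding bounded_iff by (elim exE)
  show thesis
  proof (rule that)
    fix s assume s: "s \<in> {c..<b}"
    show "F s \<le> max (1 - D) (\<bar>M\<bar> / (b - b')) * (b - s)"
    proof (cases "s \<le> b'")
      case True
      have "F s \<le> \<bar>M\<bar> / (b - b') * (b - b')"
        using bspec[OF M, of "F s"] s True b'(1) by auto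
      also have "\<dots> \<le> max (1 - D) (\<bar>M\<bar> / (b - b')) * (b - s)"
        using True b'(1) by (intro mult_mono) (auto simp: le_max_iff_disj)
      finally show ?thesis .
    next
      case False
      with b'(2)[of s] s have "F s < (D - 1) * (s - b)"
        by (simp add: neg_less_divide_eq)
      also have "\<dots> = (1 - D) * (b - s)"
        by (simp add: algebra_simps)
      also have "\<dots> \<le> max (1 - D) (\<bar>M\<bar> / (b - b')) * (b - s)"
        using s by (intro mult_right_mono) auto
      finally show ?thesis by simp
    qed
  qed
qed

text \<open>Separation of variables. The interval starts at \<open>c < a\<close> so that the inverse of the time map is
  differentiable at \<open>0\<close>; the linear bound makes the time needed to reach \<open>b\<close> infinite.\<close>
lemma increasing_flow:
  fixes F :: "real \<Rightarrow> real"
  assumes cab: "c < a" "a < b" and cont: "continuous_on {c..<b} F"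
    and pos: "\<And>s. s \<in> {c..<b} \<Longrightarrow> 0 < F s"
    and L: "\<And>s. s \<in> {c..<b} \<Longrightarrow> F s \<le> L * (b - s)"
  obtains q where "q 0 = a" "\<And>t. 0 \<le> t \<Longrightarrow> q t \<in> {a..<b}"
    "\<And>t. 0 \<le> t \<Longrightarrow> (q has_real_derivative F (q t)) (at t)" "(q \<longlongrightarrow> b) at_top"
proof -
  define G where "G = (\<lambda>s. integral {c..s} (\<lambda>s. 1 / F s) - integral {c..a} (\<lambda>s. 1 / F s))"
  have dG: "(G has_real_derivative 1 / F s) (at s)" if "s \<in> {c<..<b}" for s
  proof -
    define d where "d = (s + b) / 2"
    have d: "s < d" "d < b" using that by (simp_all add: d_def)
    have "continuous_on {c..d} F"
      using d by (intro continuous_on_subset[OF cont]) auto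
    moreover have "F x \<noteq> 0" if "x \<in> {c..d}" for x
      using pos[of x] that d by auto
    ultimately have "continuous_on {c..d} (\<lambda>s. 1 / F s)"
      by (auto intro!: continuous_intros)
    then have "((\<lambda>s. integral {c..s} (\<lambda>s. 1 / F s)) has_real_derivative 1 / F s) (at s within {c..d})"
      using that d by (intro integral_has_real_derivative) auto
    then have "((\<lambda>s. integral {c..s} (\<lambda>s. 1 / F s)) has_real_derivative 1 / F s) (at s)"
      using that d by (simp add: at_within_Icc_at)
    then show ?thesis
      unfolding G_def by (auto intro!: derivative_eq_intros)
  qed
  have contG: "continuous_on {c<..<b} G"
    by (rule DERIV_continuous_on) (rule DERIV_subset[OF dG], auto)
  have mono: "G s < G t" if "c < s" "s < t" "t < b" for s t
  proof (rule DERIV_pos_imp_increasing[OF \<open>s < t\<close>])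
    fix x assume "s \<le> x" "x \<le> t"
    with that dG[of x] pos[of x] show "\<exists>y. (G has_real_derivative y) (at x) \<and> 0 < y"
      by (intro exI[of _ "1 / F x"]) auto
  qed
  have Ga: "G a = 0" by (simp add: G_def)
  have "0 < L * (b - a)"
    using pos[of a] L[of a] cab by simp
  then have L0: "0 < L"
    using cab by (simp add: zero_less_mult_iff)
  \<comment> \<open>Comparison with the linear equation: \<open>1 / F\<close> dominates
    \<open>1 / (L * (b - s))\<close>, whose integral diverges logarithmically at
    \<open>b\<close>.\<close>
  have growth: "(ln (b - a) - ln (b - s)) / L \<le> G s" if "a \<le> s" "s < b" for s
  proof -
    have "G a + ln (b - a) / L \<le> G s + ln (b - s) / L"
    proof (rule DERIV_nonneg_imp_nondecreasing[OF \<open>a \<le> s\<close>])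
      fix x assume x: "a \<le> x" "x \<le> s"
      have "((\<lambda>s. ln (b - s) / L) has_real_derivative - (1 / (L * (b - x)))) (at x)"
        using x that cab L0 by (auto intro!: derivative_eq_intros simp: divide_simps)
      then have "((\<lambda>s. G s + ln (b - s) / L) has_real_derivative
          1 / F x + - (1 / (L * (b - x)))) (at x)"
        using x that cab by (intro DERIV_add dG) auto
      moreover have "1 / (L * (b - x)) \<le> 1 / F x"
        using x that cab pos[of x] L[of x] by (intro frac_le) auto
      ultimately show "\<exists>y. ((\<lambda>s. G s + ln (b - s) / L) has_real_derivative y) (at x) \<and> 0 \<le> y"
        by force
    qed
    then show ?thesis using Ga by (simp add: diff_divide_distrib)
  qed
  have surj: "\<exists>s\<in>{a..<b}. G s = t" if "0 \<le> t" for t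
  proof -
    \<comment> \<open>The point reached at time \<open>t\<close> by the comparison flow with speed
      \<open>L * (b - s)\<close>, so that the lower bound \<open>growth\<close> equals
      \<open>t\<close> there.\<close>
    define s1 where "s1 = b - (b - a) * exp (- L * t)"
    have "(b - a) * exp (- L * t) \<le> b - a"
      using that L0 cab by (simp add: mult_le_cancel_left1)
    then have "a \<le> s1"
      unfolding s1_def by linarith
    moreover have "s1 < b" using cab by (simp add: s1_def)
    ultimately have s1: "a \<le> s1" "s1 < b" .
    have "t \<le> G s1"
      using growth[OF s1] cab L0 by (simp add: s1_def ln_mult)
    moreover have "continuous_on {a..s1} G"
      using s1 cab by (intro continuous_on_subset[OF contG]) auto
    ultimately have "\<exists>s\<ge>a. s \<le> s1 \<and> G s = t"
      using Ga that s1 by (intro IVT') auto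
    then show ?thesis using s1 by auto
  qed
  \<comment> \<open>The flow is the inverse of the time map \<open>G\<close>, which is injective on
    the whole open interval from \<open>c\<close> to \<open>b\<close>.\<close>
  define q where "q = (\<lambda>t. THE s. s \<in> {c<..<b} \<and> G s = t)"
  have qG: "q (G s) = s" if "s \<in> {c<..<b}" for s
    unfolding q_def
  proof (rule the_equality)
    fix s' assume "s' \<in> {c<..<b} \<and> G s' = G s"
    with that show "s' = s"
      using mono[of s s'] mono[of s' s] by (cases s s' rule: linorder_cases) auto
  qed (use that in simp)
  have q: "q t \<in> {a..<b}" "G (q t) = t" if t: "0 \<le> t" for t
  proof -
    obtain s where s: "s \<in> {a..<b}" "G s = t" using surj[OF t] by blast
    then have "q t = s" using qG[of s] cab by auto
    with s show "q t \<in> {a..<b}" "G (q t) = t" by auto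
  qed
  show thesis
  proof (rule that)
    show "q 0 = a" using qG[of a] Ga cab by simp
    show "q t \<in> {a..<b}" if "0 \<le> t" for t by (rule q(1)[OF that])
    show "(q has_real_derivative F (q t)) (at t)" if t: "0 \<le> t" for t
    proof -
      have qt: "q t \<in> {c<..<b}" using q(1)[OF t] cab by auto
      have "F (q t) \<noteq> 0" using pos[of "q t"] qt by auto
      have "(q has_derivative (*) (F (q t))) (at (G (q t)))"
      proof (rule has_derivative_inverse_strong[OF open_greaterThanLessThan qt contG qG])
        show "(G has_derivative (*) (1 / F (q t))) (at (q t))"
          using dG[OF qt] by (simp add: has_field_derivative_def)
        show "(*) (1 / F (q t)) \<circ> (*) (F (q t)) = id"
          using \<open>F (q t) \<noteq> 0\<close> by (auto simp: fun_eq_iff)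
      qed
      then show ?thesis by (simp add: has_field_derivative_def q(2)[OF t])
    qed
    show "(q \<longlongrightarrow> b) at_top"
    proof (rule order_tendstoI)
      fix l assume "l < b"
      define s where "s = max l a"
      have s: "a \<le> s" "l \<le> s" "s < b" using \<open>l < b\<close> cab by (auto simp: s_def)
      show "eventually (\<lambda>t. l < q t) at_top"
        using eventually_gt_at_top[of "max 0 (G s)"]
      proof eventually_elim
        case (elim t)
        then have "G s < G (q t)" "c < q t" using q[of t] cab by auto
        then have "s < q t"
          using mono[of "q t" s] s by (cases "q t" s rule: linorder_cases) auto
        with s show ?case by simp
      qed
    next
      fix u assume "b < u"
      show "eventually (\<lambda>t. q t < u) at_top"
        using eventually_ge_at_top[of 0]
      proof eventually_elim
        case (elim t)
        with q(1)[of t] \<open>b < u\<close> show ?case by auto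
      qed
    qed
  qed
qed

text \<open>Retreating to a point \<open>c\<close> strictly between \<open>l\<close> and
  \<open>a\<close> makes \<open>F\<close> continuous up to the left end, which gives the linear
  bound required by \<open>increasing_flow\<close>.\<close>

lemma flow_to_equilibrium_from_left:
  fixes F :: "real \<Rightarrow> real"
  assumes "l < a" "a < b" "continuous_on {l<..<b} F" "F b = 0"
    and pos: "\<And>s. s \<in> {l<..<b} \<Longrightarrow> 0 < F s"
    and der: "(F has_real_derivative D) (at b)"
  obtains q where "q 0 = a" "\<And>t. 0 \<le> t \<Longrightarrow> q t \<in> {a..<b}"
    "\<And>t. 0 \<le> t \<Longrightarrow> (q has_real_derivative F (q t)) (at t)" "(q \<longlongrightarrow> b) at_top"
proof -
  define c where "c = (l + a) / 2"
  have c: "l < c" "c < a" using assms by (simp_all add: c_def)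
  have cont: "continuous_on {c..<b} F"
    using c by (intro continuous_on_subset[OF assms(3)]) auto
  obtain L where L: "\<And>s. s \<in> {c..<b} \<Longrightarrow> F s \<le> L * (b - s)"
    using bound_by_distance_to_zero[OF _ cont \<open>F b = 0\<close> der] c assms by auto
  show thesis
    by (rule increasing_flow[OF c(2) \<open>a < b\<close> cont _ L that]) (use pos c in auto)
qed

lemma flow_to_equilibrium:
  fixes F :: "real \<Rightarrow> real"
  assumes a: "a \<in> {l<..<u}" and b: "b \<in> {l<..<u}" and cont: "continuous_on {l<..<u} F"
    and Fb: "F b = 0"
    and pos: "\<And>s. l < s \<Longrightarrow> s < b \<Longrightarrow> 0 < F s" and neg: "\<And>s. b < s \<Longrightarrow> s < u \<Longrightarrow> F s < 0"
    and der: "(F has_real_derivative D) (at b)"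
  obtains q where "q 0 = a" "\<And>t. 0 \<le> t \<Longrightarrow> q t \<in> {l<..<u}"
    "\<And>t. 0 \<le> t \<Longrightarrow> (q has_real_derivative F (q t)) (at t)" "(q \<longlongrightarrow> b) at_top"
proof (cases a b rule: linorder_cases)
  case less
  have "continuous_on {l<..<b} F"
    using b by (intro continuous_on_subset[OF cont]) auto
  then obtain q where "q 0 = a" "\<And>t. 0 \<le> t \<Longrightarrow> q t \<in> {a..<b}"
    "\<And>t. 0 \<le> t \<Longrightarrow> (q has_real_derivative F (q t)) (at t)" "(q \<longlongrightarrow> b) at_top"
    using flow_to_equilibrium_from_left[of l a b F D] less a Fb pos der by auto
  then show thesis using that[of q] a b by fastforce
next
  case equal
  show thesis by (rule that[of "\<lambda>_. a"]) (use a equal Fb in auto)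
next
  case greater
  \<comment> \<open>The reflection of the line turns a start to the right of \<open>b\<close> into
    one to the left of \<open>- b\<close>.\<close>
  let ?F = "\<lambda>s. - F (- s)"
  have "continuous_on {-u<..<-b} ?F"
    using b by (intro continuous_intros continuous_on_compose2[OF cont]) auto
  moreover have "(?F has_real_derivative D) (at (- b))"
    using der by (auto intro!: derivative_eq_intros DERIV_chain2[where f = F and g = uminus])
  ultimately obtain q where q: "q 0 = - a" "\<And>t. 0 \<le> t \<Longrightarrow> q t \<in> {-a..<-b}"
    "\<And>t. 0 \<le> t \<Longrightarrow> (q has_real_derivative ?F (q t)) (at t)" "(q \<longlongrightarrow> - b) at_top"
    using flow_to_equilibrium_from_left[of "-u" "-a" "-b" ?F D] greater a Fb neg by auto
  show thesis
  proof (rule that[of "\<lambda>t. - q t"])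
    show "- q t \<in> {l<..<u}" if "0 \<le> t" for t using q(2)[OF that] a b by auto
    show "((\<lambda>t. - q t) has_real_derivative F (- q t)) (at t)" if "0 \<le> t" for t
      using DERIV_minus[OF q(3)[OF that]] by simp
    show "((\<lambda>t. - q t) \<longlongrightarrow> b) at_top" using tendsto_minus[OF q(4)] by simp
  qed (use q(1) in simp)
qed

section \<open>The reduced system\<close>

lemma norm_unit_vec: "norm (unit_vec \<theta>) = 1"
  by (simp add: unit_vec_conv_cis norm_vec_of_complex)

lemma inj_on_unit_vec_ring_angle: "inj_on (\<lambda>j. unit_vec (ring_angle n \<theta>0 j)) {1..n}"
proof (cases "n = 0")
  case False
  have "inj vec_of_complex"
  proof (rule injI)
    fix z w assume "vec_of_complex z = vec_of_complex w"
    then have "norm (vec_of_complex (z - w)) = 0"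
      by (simp add: linear_diff[OF linear_vec_of_complex])
    then show "z = w" by (simp add: norm_vec_of_complex)
  qed
  moreover have "inj_on (\<lambda>j. cis (ring_angle n \<theta>0 j)) {1..n}"
    using bij_betw_cis_ring_angle[of n \<theta>0] False by (simp add: bij_betw_def)
  ultimately have "inj_on (vec_of_complex \<circ> (\<lambda>j. cis (ring_angle n \<theta>0 j))) {1..n}"
    by (blast intro: comp_inj_on inj_on_subset)
  then show ?thesis
    by (simp add: unit_vec_conv_cis comp_def)
qed simp

section \<open>The symmetric two-ring configuration\<close>

text \<open>The left side is the rate of change of the squared radius; multiplying by
  \<open>r\<close> completes \<open>r ^ (n - 1)\<close> to \<open>r ^ n\<close>.\<close>

lemma two_times_ring_speed:
  assumes "0 < n" "0 < r"
  shows "2 * r * ring_speed n r s = 2 * (real n - 1) + 4 * real n * r ^ n / (r ^ n - s ^ n)"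
proof -
  have "r * r ^ (n - 1) = r ^ n" using assms by (cases n) auto
  then show ?thesis
    using assms by (simp add: ring_speed_def distrib_left of_nat_diff mult_ac)
qed

definition two_rings ::
  "nat \<Rightarrow> real \<Rightarrow> (real \<Rightarrow> real) \<Rightarrow> (real \<Rightarrow> real) \<Rightarrow> nat \<Rightarrow> real \<Rightarrow> real^2" where
  "two_rings n \<theta>0 \<rho>1 \<rho>2 j t =
     (if j \<le> n then sqrt (\<rho>1 t) *\<^sub>R unit_vec (ring_angle n \<theta>0 j)
      else sqrt (\<rho>2 t) *\<^sub>R unit_vec (ring_angle n \<theta>0 (j - n)))"

lemma two_rings_simps:
  assumes "j \<in> {1..n}"
  shows "two_rings n \<theta>0 \<rho>1 \<rho>2 j = (\<lambda>t. sqrt (\<rho>1 t) *\<^sub>R unit_vec (ring_angle n \<theta>0 j))"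
    and "two_rings n \<theta>0 \<rho>1 \<rho>2 (n + j) = (\<lambda>t. sqrt (\<rho>2 t) *\<^sub>R unit_vec (ring_angle n \<theta>0 j))"
  using assms by (auto simp: two_rings_def fun_eq_iff)

lemma two_rings_index_cases:
  assumes "j \<in> {1..2*n::nat}"
  obtains "j \<in> {1..n}" | i where "i \<in> {1..n}" "j = n + i"
proof (cases "j \<le> n")
  case False
  then show thesis using assms that(2)[of "j - n"] by auto
qed (use assms that in auto)

text \<open>Vortices on different rings differ in norm, those on the same ring in direction.\<close>

lemma inj_on_two_rings:
  assumes "0 < \<rho>1 t" "\<rho>1 t < \<rho>2 t"
  shows "inj_on (\<lambda>j. two_rings n \<theta>0 \<rho>1 \<rho>2 j t) {1..2*n}"
proof (rule inj_onI)
  fix j k assume j: "j \<in> {1..2*n}" and k: "k \<in> {1..2*n}"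
    and eq: "two_rings n \<theta>0 \<rho>1 \<rho>2 j t = two_rings n \<theta>0 \<rho>1 \<rho>2 k t"
  have n: "norm (two_rings n \<theta>0 \<rho>1 \<rho>2 i t) = (if i \<le> n then sqrt (\<rho>1 t) else sqrt (\<rho>2 t))" for i
    using assms by (simp add: two_rings_def norm_unit_vec)
  have same: "j \<le> n \<longleftrightarrow> k \<le> n"
    using n[of j] n[of k] eq assms by (auto split: if_splits)
  note inj = inj_onD[OF inj_on_unit_vec_ring_angle[of n \<theta>0]]
  show "j = k"
  proof (cases "j \<le> n")
    case True
    with same eq assms have "unit_vec (ring_angle n \<theta>0 j) = unit_vec (ring_angle n \<theta>0 k)"
      by (simp add: two_rings_def)
    then show ?thesis using inj[of j k] True same j k by auto
  next
    case False
    with same eq assms have "unit_vec (ring_angle n \<theta>0 (j - n)) = unit_vec (ring_angle n \<theta>0 (k - n))"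
      by (simp add: two_rings_def)
    moreover have "j - n \<in> {1..n}" "k - n \<in> {1..n}" using False same j k by auto
    ultimately have "j - n = k - n" using inj[of "j - n" "k - n"] by simp
    then show ?thesis using False same by auto
  qed
qed

text \<open>By the chain rule \<open>sqrt (\<rho> t)\<close> moves with speed
  \<open>ring_speed\<close>, which is the radial velocity found in
  \<open>vortex_velocity_two_rings\<close>.\<close>

lemma vortex_solution_two_rings:
  fixes p :: "nat \<Rightarrow> real^2"
  assumes m: "\<forall>j\<in>{1..2*n}. m j = m0" "m0 \<in> {1, -1}" and n: "0 < n"
    and pos: "\<And>t. 0 \<le> t \<Longrightarrow> 0 < \<rho>1 t" "\<And>t. 0 \<le> t \<Longrightarrow> \<rho>1 t < \<rho>2 t"
    and cont: "continuous_on {0..} \<rho>1" "continuous_on {0..} \<rho>2"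
    and d1: "\<And>t. 0 < t \<Longrightarrow> (\<rho>1 has_real_derivative
        2 * sqrt (\<rho>1 t) * ring_speed n (sqrt (\<rho>1 t)) (sqrt (\<rho>2 t))) (at t)"
    and d2: "\<And>t. 0 < t \<Longrightarrow> (\<rho>2 has_real_derivative
        2 * sqrt (\<rho>2 t) * ring_speed n (sqrt (\<rho>2 t)) (sqrt (\<rho>1 t))) (at t)"
    and p: "\<forall>j\<in>{1..n}. p j = sqrt (\<rho>1 0) *\<^sub>R unit_vec (ring_angle n \<theta>0 j) \<and>
              p (n + j) = sqrt (\<rho>2 0) *\<^sub>R unit_vec (ring_angle n \<theta>0 j)"
  shows "vortex_solution (2 * n) m p (two_rings n \<theta>0 \<rho>1 \<rho>2)" (is "vortex_solution _ m p ?x")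
proof -
  have pos2: "0 < \<rho>2 t" if "0 \<le> t" for t using pos[OF that] by linarith
  have "?x j 0 = p j \<and> continuous_on {0..} (?x j)" if "j \<in> {1..2*n}" for j
    using that
  proof (cases rule: two_rings_index_cases)
    case 1
    then show ?thesis
      using p cont by (auto simp: two_rings_simps intro!: continuous_intros)
  next
    case (2 i)
    then show ?thesis
      using p cont by (auto simp: two_rings_simps intro!: continuous_intros)
  qed
  moreover have "?x j t \<noteq> ?x k t" if "0 \<le> t" "j \<in> {1..2*n}" "k \<in> {1..2*n}" "j \<noteq> k" for t j k
    using inj_on_contraD[OF inj_on_two_rings[of \<rho>1 t \<rho>2, OF pos[OF that(1)]] that(4,2,3)] .
  moreover have "(?x j has_vector_derivative vortex_velocity (2 * n) m (\<lambda>k. ?x k t) j) (at t)"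
    if t: "0 < t" and j: "j \<in> {1..2*n}" for t j
  proof -
    have sq: "((\<lambda>t. sqrt (\<rho> t) *\<^sub>R v) has_vector_derivative D *\<^sub>R v) (at t)"
      if "(\<rho> has_real_derivative 2 * sqrt (\<rho> t) * D) (at t)" "0 < \<rho> t" for \<rho> D and v :: "real^2"
    proof -
      have "((\<lambda>t. sqrt (\<rho> t)) has_real_derivative inverse (sqrt (\<rho> t)) / 2 * (2 * sqrt (\<rho> t) * D)) (at t)"
        by (rule DERIV_chain2[where f = sqrt, OF DERIV_real_sqrt that(1)]) (rule that(2))
      then have "((\<lambda>t. sqrt (\<rho> t)) has_real_derivative D) (at t)"
        using that(2) by (simp add: field_simps)
      from has_vector_derivative_scaleR[OF this has_vector_derivative_const, of v]
      show ?thesis by simp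
    qed
    have r: "0 < sqrt (\<rho>1 t)" "0 < sqrt (\<rho>2 t)" "sqrt (\<rho>1 t) \<noteq> sqrt (\<rho>2 t)"
      using pos[of t] pos2[of t] t by auto
    have q: "\<forall>j\<in>{1..n}. ?x j t = sqrt (\<rho>1 t) *\<^sub>R unit_vec (ring_angle n \<theta>0 j) \<and>
        ?x (n + j) t = sqrt (\<rho>2 t) *\<^sub>R unit_vec (ring_angle n \<theta>0 j)"
      by (simp add: two_rings_simps)
    note vel = vortex_velocity_two_rings[OF m r q]
    show ?thesis
      using j
    proof (cases rule: two_rings_index_cases)
      case 1
      show ?thesis
        unfolding two_rings_simps(1)[OF 1] vel(1)[OF 1] using pos[of t] t by (intro sq d1) auto
    next
      case (2 i)
      show ?thesis
        unfolding \<open>j = n + i\<close> two_rings_simps(2)[OF 2(1)] vel(2)[OF 2(1)]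
        using pos2[of t] t by (intro sq d2) auto
    qed
  qed
  ultimately show ?thesis by (simp add: vortex_solution_def)
qed

text \<open>For the normalised gap \<open>q = (\<rho>2 - \<rho>1) / (\<rho>2 + \<rho>1)\<close> the gap \<open>\<rho>2 - \<rho>1\<close> grows at the
  rate \<open>4 n gap_rate n q\<close>, while \<open>\<rho>2 + \<rho>1\<close> grows at the constant rate \<open>8 n - 4\<close>.\<close>
definition gap_rate :: "nat \<Rightarrow> real \<Rightarrow> real" where
  "gap_rate n q = (sqrt (1 + q) ^ n + sqrt (1 - q) ^ n) / (sqrt (1 + q) ^ n - sqrt (1 - q) ^ n)"

definition gap_drift :: "nat \<Rightarrow> real \<Rightarrow> real" where
  "gap_drift n q = 4 * real n * gap_rate n q - (8 * real n - 4) * q"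

section \<open>Monotonicity and equilibrium of the gap drift\<close>

lemma sqrt_power_less:
  assumes "0 < n" "0 < q" "q \<le> 1"
  shows "sqrt (1 - q) ^ n < sqrt (1 + q) ^ n"
  using assms by (intro power_strict_mono) auto

lemma gap_rate_ge_1:
  assumes "0 < n" "0 < q" "q \<le> 1"
  shows "1 \<le> gap_rate n q"
  using sqrt_power_less[OF assms] assms by (simp add: gap_rate_def)

text \<open>As \<open>q\<close> grows, the ratio of \<open>sqrt (1 - q) ^ n\<close> to
  \<open>sqrt (1 + q) ^ n\<close> falls, so \<open>gap_rate\<close> cannot increase; the linear term
  makes the decrease strict.\<close>

lemma gap_drift_strict_antimono:
  assumes "0 < n" "0 < q" "q < q'" "q' \<le> 1"
  shows "gap_drift n q' < gap_drift n q"
proof -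
  define B A B' A' where "B = sqrt (1 + q) ^ n" and "A = sqrt (1 - q) ^ n"
    and "B' = sqrt (1 + q') ^ n" and "A' = sqrt (1 - q') ^ n"
  have "A < B" "A' < B'" "0 \<le> A'"
    using assms sqrt_power_less[of n q] sqrt_power_less[of n q']
    by (simp_all add: A_def B_def A'_def B'_def)
  moreover have "A' < A" "B < B'"
    using assms unfolding A_def A'_def B_def B'_def by (auto intro!: power_strict_mono)
  ultimately have "A' * B \<le> A * B'"
    by (intro mult_mono) auto
  with \<open>A < B\<close> \<open>A' < B'\<close> have "(B' + A') / (B' - A') \<le> (B + A) / (B - A)"
    by (simp add: divide_simps) (simp add: algebra_simps)
  then have "gap_rate n q' \<le> gap_rate n q"
    by (simp add: gap_rate_def A_def B_def A'_def B'_def)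
  moreover have "(8 * real n - 4) * q < (8 * real n - 4) * q'"
    using assms by (intro mult_strict_left_mono) auto
  moreover from calculation(1) have "4 * real n * gap_rate n q' \<le> 4 * real n * gap_rate n q"
    by (intro mult_left_mono) auto
  ultimately show ?thesis unfolding gap_drift_def by linarith
qed

lemma gap_drift_differentiable:
  assumes "0 < n" "q \<in> {0<..<1}"
  shows "\<exists>D. (gap_drift n has_real_derivative D) (at q)"
proof -
  have "((\<lambda>q. sqrt (1 + q)) has_real_derivative inverse (sqrt (1 + q)) / 2) (at q)"
    using assms by (auto intro!: derivative_eq_intros)
  from DERIV_power[OF this, of n] obtain E
    where E: "((\<lambda>q. sqrt (1 + q) ^ n) has_real_derivative E) (at q)" by blast
  have "((\<lambda>q. sqrt (1 - q)) has_real_derivative - inverse (sqrt (1 - q)) / 2) (at q)"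
    using assms by (auto intro!: derivative_eq_intros)
  from DERIV_power[OF this, of n] obtain E'
    where E': "((\<lambda>q. sqrt (1 - q) ^ n) has_real_derivative E') (at q)" by blast
  have "sqrt (1 + q) ^ n - sqrt (1 - q) ^ n \<noteq> 0"
    using sqrt_power_less[of n q] assms by simp
  from DERIV_divide[OF DERIV_add[OF E E'] DERIV_diff[OF E E'] this]
  obtain H where H: "(gap_rate n has_real_derivative H) (at q)"
    unfolding gap_rate_def by blast
  from DERIV_diff[OF DERIV_cmult[OF H, of "4 * real n"] DERIV_cmult[OF DERIV_ident, of "8 * real n - 4"]]
  show ?thesis unfolding gap_drift_def by blast
qed

text \<open>Intermediate values: at \<open>1/2\<close> the drift is at least
  \<open>4 * n - (4 * n - 2) = 2\<close> because \<open>gap_rate\<close> is at least 1, and at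
  \<open>1\<close> it equals \<open>4 - 4 * n\<close> because \<open>gap_rate\<close> is 1
  there.\<close>

lemma gap_equilibrium_exists:
  assumes "2 \<le> n"
  shows "\<exists>b\<in>{1/2<..<1}. gap_drift n b = 0"
proof -
  have n: "0 < n" using assms by simp
  have "sqrt (1 + q) ^ n - sqrt (1 - q) ^ n \<noteq> 0" if "q \<in> {1/2..1}" for q
    using sqrt_power_less[of n q] that n by simp
  then have "continuous_on {1/2..1} (gap_drift n)"
    unfolding gap_drift_def gap_rate_def by (auto intro!: continuous_intros)
  moreover have d1: "gap_drift n 1 < 0"
    using assms by (simp add: gap_drift_def gap_rate_def power_0_left)
  moreover have d2: "0 < gap_drift n (1/2)"
  proof -
    have "real n * 1 \<le> real n * gap_rate n (1/2)"
      using gap_rate_ge_1[of n "1/2"] n by (intro mult_left_mono) auto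
    then show ?thesis by (simp add: gap_drift_def)
  qed
  ultimately obtain b where b: "1/2 \<le> b" "b \<le> 1" "gap_drift n b = 0"
    using IVT2'[of "gap_drift n" 1 0 "1/2"] by force
  from d1 d2 have "b \<noteq> 1" "b \<noteq> 1/2" by (metis b(3) less_irrefl)+
  with b show ?thesis by (intro bexI[of _ b]) auto
qed

text \<open>The common scale \<open>c\<close> cancels from the quotients of \<open>n\<close>-th
  powers, so the rates of the squared radii depend on \<open>q\<close> alone. Here \<open>c\<close>
  stands for half the sum of the squared radii.\<close>

lemma gap_rate_scaled:
  assumes "0 < n" "0 < c" "0 < q" "q < 1"
  defines "r \<equiv> sqrt (c * (1 - q))" and "s \<equiv> sqrt (c * (1 + q))"
  shows "2 * s * ring_speed n s r = (4 * real n - 2) + 2 * real n * gap_rate n q"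
    and "2 * r * ring_speed n r s = (4 * real n - 2) - 2 * real n * gap_rate n q"
proof -
  have pos: "0 < r" "0 < s" using assms by simp_all
  define B A where "B = sqrt (1 + q) ^ n" and "A = sqrt (1 - q) ^ n"
  have AB: "A < B" using sqrt_power_less[of n q] assms by (simp add: A_def B_def)
  define e where "e = sqrt c ^ n"
  have e: "0 < e" using assms by (simp add: e_def)
  have rs: "r ^ n = e * A" "s ^ n = e * B"
    by (simp_all add: r_def s_def e_def A_def B_def real_sqrt_mult power_mult_distrib)
  have "2 * s * ring_speed n s r = 2 * (real n - 1) + 4 * real n * (B / (B - A))"
    using e AB by (simp add: two_times_ring_speed[OF assms(1) pos(2)] rs flip: right_diff_distrib)
  moreover have "2 * r * ring_speed n r s = 2 * (real n - 1) + 4 * real n * (A / (A - B))"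
    using e AB by (simp add: two_times_ring_speed[OF assms(1) pos(1)] rs flip: right_diff_distrib)
  moreover have "B / (B - A) = (gap_rate n q + 1) / 2" "A / (A - B) = (1 - gap_rate n q) / 2"
    using AB unfolding gap_rate_def A_def[symmetric] B_def[symmetric] by (simp_all add: divide_simps, simp_all add: algebra_simps)
  ultimately show "2 * s * ring_speed n s r = (4 * real n - 2) + 2 * real n * gap_rate n q"
    and "2 * r * ring_speed n r s = (4 * real n - 2) - 2 * real n * gap_rate n q"
    by (simp_all add: field_simps)
qed

text \<open>In the time \<open>\<tau>\<close> with \<open>d\<tau> = dt / (\<rho>1 + \<rho>2)\<close> the normalised gap obeys the autonomous
  equation \<open>dq/d\<tau> = gap_drift n q\<close>.\<close>
lemma two_ring_radii_exist:
  assumes n: "2 \<le> n" and C: "0 < C2" "C2 < C1"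
    and b: "b \<in> {0<..<1}" "gap_drift n b = 0"
  obtains \<rho>1 \<rho>2 :: "real \<Rightarrow> real" where "\<rho>1 0 = C1 - C2" "\<rho>2 0 = C1 + C2"
    "\<And>t. 0 \<le> t \<Longrightarrow> 0 < \<rho>1 t" "\<And>t. 0 \<le> t \<Longrightarrow> \<rho>1 t < \<rho>2 t"
    "\<And>t. 0 \<le> t \<Longrightarrow> (\<rho>1 has_real_derivative
        2 * sqrt (\<rho>1 t) * ring_speed n (sqrt (\<rho>1 t)) (sqrt (\<rho>2 t))) (at t)"
    "\<And>t. 0 \<le> t \<Longrightarrow> (\<rho>2 has_real_derivative
        2 * sqrt (\<rho>2 t) * ring_speed n (sqrt (\<rho>2 t)) (sqrt (\<rho>1 t))) (at t)"
    "((\<lambda>t. \<rho>1 t / t) \<longlongrightarrow> (4 * real n - 2) * (1 - b)) at_top"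
    "((\<lambda>t. \<rho>2 t / t) \<longlongrightarrow> (4 * real n - 2) * (1 + b)) at_top"
proof -
  have n0: "0 < n" using n by simp
  define k where "k = 8 * real n - 4"
  have k: "0 < k" using n by (simp add: k_def)
  have "\<exists>D. (gap_drift n has_real_derivative D) (at b)"
    by (rule gap_drift_differentiable[OF n0 b(1)])
  then obtain D where D: "(gap_drift n has_real_derivative D) (at b)" by blast
  have cont: "continuous_on {0<..<1} (gap_drift n)"
  proof (rule continuous_at_imp_continuous_on, rule ballI)
    fix s :: real assume "s \<in> {0<..<1}"
    then show "isCont (gap_drift n) s"
      using gap_drift_differentiable[OF n0] DERIV_isCont by blast
  qed
  have init: "C2 / C1 \<in> {0<..<1}" using C by simp
  have pos: "0 < gap_drift n s" if "0 < s" "s < b" for s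
    using gap_drift_strict_antimono[OF n0 that] b by simp
  have neg: "gap_drift n s < 0" if "b < s" "s < 1" for s
    using gap_drift_strict_antimono[OF n0 _ that(1)] that b by simp
  obtain q where q: "q 0 = C2 / C1" "\<And>t. 0 \<le> t \<Longrightarrow> q t \<in> {0<..<1}"
    "\<And>t. 0 \<le> t \<Longrightarrow> (q has_real_derivative gap_drift n (q t)) (at t)" "(q \<longlongrightarrow> b) at_top"
    using flow_to_equilibrium[OF init b(1) cont b(2) pos neg D] by blast
  define S where "S = (\<lambda>t. 2 * C1 + k * t)"
  \<comment> \<open>The integral of \<open>1 / S\<close> from 0 to \<open>t\<close>, where
    \<open>S\<close> will be the sum of the squared radii.\<close>
  define \<tau> where "\<tau> = (\<lambda>t. (1 / k) * (- ln (2 * C1) + ln (S t)))"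
  define Q where "Q = (\<lambda>t. q (\<tau> t))"
  have S: "0 < S t" if "0 \<le> t" for t
    using that k C by (simp add: S_def add_pos_nonneg)
  have dS: "(S has_real_derivative k) (at t)" for t
    unfolding S_def by (auto intro!: derivative_eq_intros)
  have \<tau>: "0 \<le> \<tau> t" if "0 \<le> t" for t
  proof -
    have "ln (2 * C1) \<le> ln (S t)"
      using that k C by (intro ln_mono) (auto simp: S_def)
    then show ?thesis using k by (simp add: \<tau>_def)
  qed
  have Q: "Q t \<in> {0<..<1}" if "0 \<le> t" for t
    unfolding Q_def by (rule q(2)[OF \<tau>[OF that]])
  have dQ: "(Q has_real_derivative gap_drift n (Q t) / S t) (at t)" if t: "0 \<le> t" for t
  proof -
    have "((\<lambda>t. ln (S t)) has_real_derivative 1 / S t * k) (at t)"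
      by (rule DERIV_chain2[OF DERIV_ln_divide[OF S[OF t]] dS])
    from DERIV_cmult[OF DERIV_add[OF DERIV_const[of "- ln (2 * C1)"] this], of "1 / k"]
    have "(\<tau> has_real_derivative 1 / S t) (at t)"
      unfolding \<tau>_def using k by simp
    from DERIV_chain2[OF q(3)[OF \<tau>[OF t]] this] show ?thesis
      unfolding Q_def by simp
  qed
  define \<rho>1 \<rho>2 where "\<rho>1 = (\<lambda>t. S t / 2 * (1 - Q t))" and "\<rho>2 = (\<lambda>t. S t / 2 * (1 + Q t))"
  have drift: "gap_drift n s = 4 * real n * gap_rate n s - k * s" for s
    by (simp add: gap_drift_def k_def)
  have "filterlim S at_top at_top"
    unfolding S_def
    by (intro filterlim_tendsto_add_at_top[OF tendsto_const]
        filterlim_tendsto_pos_mult_at_top[OF tendsto_const k filterlim_ident])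
  \<comment> \<open>Logarithmic time is unbounded, so the limit of \<open>q\<close> passes to
    \<open>Q\<close>.\<close>
  then have "filterlim \<tau> at_top at_top"
    unfolding \<tau>_def using k
    by (intro filterlim_tendsto_pos_mult_at_top[OF tendsto_const]
        filterlim_tendsto_add_at_top[OF tendsto_const] filterlim_compose[OF ln_at_top]) auto
  then have Q_lim: "(Q \<longlongrightarrow> b) at_top"
    unfolding Q_def by (rule filterlim_compose[OF q(4)])
  have "((\<lambda>t. 2 * C1 / t + k) \<longlongrightarrow> 0 + k) at_top"
    by (intro tendsto_add tendsto_const tendsto_divide_0[OF tendsto_const])
       (rule filterlim_at_top_imp_at_infinity[OF filterlim_ident])
  moreover have "eventually (\<lambda>t. 2 * C1 / t + k = S t / t) at_top"
    using eventually_gt_at_top[of 0] by eventually_elim (simp add: S_def field_simps)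
  ultimately have S_lim: "((\<lambda>t. S t / t) \<longlongrightarrow> k) at_top"
    by (simp add: tendsto_cong)
  show thesis
  proof (rule that)
    have "Q 0 = C2 / C1" by (simp add: Q_def \<tau>_def S_def q(1))
    then show "\<rho>1 0 = C1 - C2" "\<rho>2 0 = C1 + C2"
      using C by (simp_all add: \<rho>1_def \<rho>2_def S_def field_simps)
    show "0 < \<rho>1 t" "\<rho>1 t < \<rho>2 t" if "0 \<le> t" for t
      using S[OF that] Q[OF that] by (simp_all add: \<rho>1_def \<rho>2_def)
    show "(\<rho>1 has_real_derivative 2 * sqrt (\<rho>1 t) * ring_speed n (sqrt (\<rho>1 t)) (sqrt (\<rho>2 t))) (at t)"
      if t: "0 \<le> t" for t
    proof -
      have "(\<rho>1 has_real_derivative k / 2 * (1 - Q t) + S t / 2 * (- (gap_drift n (Q t) / S t))) (at t)"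
        unfolding \<rho>1_def by (auto intro!: derivative_eq_intros dS dQ[OF t])
      \<comment> \<open>The terms linear in \<open>Q t\<close> cancel: \<open>gap_drift\<close>
        subtracts exactly the part \<open>k * Q t\<close> due to the growth of the sum.\<close>
      moreover have "k / 2 * (1 - Q t) + S t / 2 * (- (gap_drift n (Q t) / S t))
          = (4 * real n - 2) - 2 * real n * gap_rate n (Q t)"
        using S[OF t] by (simp add: drift field_simps) (simp add: k_def field_simps)
      moreover have "2 * sqrt (\<rho>1 t) * ring_speed n (sqrt (\<rho>1 t)) (sqrt (\<rho>2 t))
          = (4 * real n - 2) - 2 * real n * gap_rate n (Q t)"
        unfolding \<rho>1_def \<rho>2_def using S[OF t] Q[OF t] n0 by (intro gap_rate_scaled(2)) auto
      ultimately show ?thesis by simp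
    qed
    show "(\<rho>2 has_real_derivative 2 * sqrt (\<rho>2 t) * ring_speed n (sqrt (\<rho>2 t)) (sqrt (\<rho>1 t))) (at t)"
      if t: "0 \<le> t" for t
    proof -
      have "(\<rho>2 has_real_derivative k / 2 * (1 + Q t) + S t / 2 * (gap_drift n (Q t) / S t)) (at t)"
        unfolding \<rho>2_def by (auto intro!: derivative_eq_intros dS dQ[OF t])
      moreover have "k / 2 * (1 + Q t) + S t / 2 * (gap_drift n (Q t) / S t)
          = (4 * real n - 2) + 2 * real n * gap_rate n (Q t)"
        using S[OF t] by (simp add: drift field_simps) (simp add: k_def field_simps)
      moreover have "2 * sqrt (\<rho>2 t) * ring_speed n (sqrt (\<rho>2 t)) (sqrt (\<rho>1 t))
          = (4 * real n - 2) + 2 * real n * gap_rate n (Q t)"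
        unfolding \<rho>1_def \<rho>2_def using S[OF t] Q[OF t] n0 by (intro gap_rate_scaled(1)) auto
      ultimately show ?thesis by simp
    qed
    have half: "k / 2 = 4 * real n - 2" by (simp add: k_def)
    have "((\<lambda>t. S t / t / 2 * (1 - Q t)) \<longlongrightarrow> k / 2 * (1 - b)) at_top"
      "((\<lambda>t. S t / t / 2 * (1 + Q t)) \<longlongrightarrow> k / 2 * (1 + b)) at_top"
      by (intro tendsto_intros S_lim Q_lim; simp)+
    then show "((\<lambda>t. \<rho>1 t / t) \<longlongrightarrow> (4 * real n - 2) * (1 - b)) at_top"
      "((\<lambda>t. \<rho>2 t / t) \<longlongrightarrow> (4 * real n - 2) * (1 + b)) at_top"
      unfolding half by (simp_all add: \<rho>1_def \<rho>2_def mult.commute)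
  qed
qed

text \<open>For \<open>n = 2\<close> the powers are the squared radii themselves, so the rates are
  rational in them. With half-gap \<open>R\<close> the system reduces to
  \<open>R * R' = 4 * C1 + 24 * t\<close>, which integrates to the stated root.\<close>

lemma two_ring_radii_2:
  fixes C1 C2 :: real
  assumes C: "0 < C2" "C2 < C1"
  defines "R \<equiv> \<lambda>t. sqrt (C2\<^sup>2 + 8 * C1 * t + 24 * t\<^sup>2)"
  defines "\<rho>1 \<equiv> \<lambda>t. C1 + 6 * t - R t" and "\<rho>2 \<equiv> \<lambda>t. C1 + 6 * t + R t"
  assumes t: "0 \<le> t"
  shows "0 < \<rho>1 t" "\<rho>1 t < \<rho>2 t"
    "(\<rho>1 has_real_derivative 2 * sqrt (\<rho>1 t) * ring_speed 2 (sqrt (\<rho>1 t)) (sqrt (\<rho>2 t))) (at t)"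
    "(\<rho>2 has_real_derivative 2 * sqrt (\<rho>2 t) * ring_speed 2 (sqrt (\<rho>2 t)) (sqrt (\<rho>1 t))) (at t)"
proof -
  have pos: "0 < C2\<^sup>2 + 8 * C1 * t + 24 * t\<^sup>2"
    using C t by (intro add_pos_nonneg) auto
  then have R: "0 < R t" by (simp add: R_def)
  have "C2\<^sup>2 < C1\<^sup>2" using C by (intro power_strict_mono) auto
  moreover have "0 \<le> C1 * t" using C t by simp
  moreover have "(C1 + 6 * t)\<^sup>2 = C1\<^sup>2 + 12 * (C1 * t) + 36 * t\<^sup>2"
    by (simp add: power2_eq_square algebra_simps)
  moreover have "0 \<le> t\<^sup>2" by simp
  ultimately have "C2\<^sup>2 + 8 * C1 * t + 24 * t\<^sup>2 < (C1 + 6 * t)\<^sup>2" by linarith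
  then have "R t < C1 + 6 * t"
    unfolding R_def using C t by (intro real_less_lsqrt) auto
  then show \<rho>1: "0 < \<rho>1 t" and less: "\<rho>1 t < \<rho>2 t"
    using R by (simp_all add: \<rho>1_def \<rho>2_def)
  then have \<rho>2: "0 < \<rho>2 t" by linarith
  have "((\<lambda>t. C2\<^sup>2 + 8 * C1 * t + 24 * t\<^sup>2) has_real_derivative 8 * C1 + 48 * t) (at t)"
    by (auto intro!: derivative_eq_intros)
  from DERIV_chain2[where f = sqrt, OF DERIV_real_sqrt[OF pos] this]
  have "(R has_real_derivative inverse (R t) / 2 * (8 * C1 + 48 * t)) (at t)"
    unfolding R_def .
  then have dR: "(R has_real_derivative (4 * C1 + 24 * t) / R t) (at t)"
    by (rule DERIV_cong) (use R in \<open>simp add: field_simps\<close>)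
  have "(\<rho>1 has_real_derivative 6 - (4 * C1 + 24 * t) / R t) (at t)"
    "(\<rho>2 has_real_derivative 6 + (4 * C1 + 24 * t) / R t) (at t)"
    unfolding \<rho>1_def \<rho>2_def by (auto intro!: derivative_eq_intros dR)
  moreover have "2 * sqrt (\<rho>1 t) * ring_speed 2 (sqrt (\<rho>1 t)) (sqrt (\<rho>2 t))
      = 6 - (4 * C1 + 24 * t) / R t"
    "2 * sqrt (\<rho>2 t) * ring_speed 2 (sqrt (\<rho>2 t)) (sqrt (\<rho>1 t))
      = 6 + (4 * C1 + 24 * t) / R t"
    using \<rho>1 \<rho>2 R by (simp_all add: two_times_ring_speed) (simp_all add: \<rho>1_def \<rho>2_def field_simps)
  ultimately show
    "(\<rho>1 has_real_derivative 2 * sqrt (\<rho>1 t) * ring_speed 2 (sqrt (\<rho>1 t)) (sqrt (\<rho>2 t))) (at t)"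
    "(\<rho>2 has_real_derivative 2 * sqrt (\<rho>2 t) * ring_speed 2 (sqrt (\<rho>2 t)) (sqrt (\<rho>1 t))) (at t)"
    by simp_all
qed

section \<open>The growth constants for large \<open>n\<close>\<close>

text \<open>From \<open>b \<ge> 1/2\<close> follows \<open>(1 - b) / (1 + b) \<le> 1/3\<close>, so
  the quotient of the two powers is at most \<open>(1 / sqrt 3) ^ n\<close>.\<close>

lemma gap_rate_equilibrium_bound:
  assumes n: "2 \<le> n" and b: "1 / 2 \<le> b" "b \<le> 1"
  shows "gap_rate n b - 1 \<le> 4 * (1 / sqrt 3) ^ n"
proof -
  define B A e where "B = sqrt (1 + b) ^ n" and "A = sqrt (1 - b) ^ n" and "e = (1 / sqrt 3) ^ n"
  have AB: "A < B" using sqrt_power_less[of n b] assms by (simp add: A_def B_def)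
  have B: "0 < B" using b by (simp add: B_def)
  have "sqrt (1 - b) \<le> sqrt ((1 + b) / 3)" using b by simp
  also have "\<dots> = 1 / sqrt 3 * sqrt (1 + b)" by (simp add: real_sqrt_divide)
  finally have "A \<le> (1 / sqrt 3 * sqrt (1 + b)) ^ n"
    unfolding A_def using b by (intro power_mono) auto
  then have AeB: "A \<le> e * B" by (simp add: e_def B_def power_mult_distrib power_divide)
  \<comment> \<open>With \<open>n \<ge> 2\<close> this gives \<open>e \<le> 1/3\<close>, which keeps
    the denominator \<open>B - A\<close> above \<open>B / 2\<close>.\<close>
  have "e \<le> (1 / sqrt 3) ^ 2"
    unfolding e_def using n by (intro power_decreasing) auto
  then have "e \<le> 1 / 2" by (simp add: power_divide)
  then have "e * B \<le> 1 / 2 * B" using B by (intro mult_right_mono) auto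
  then have half: "B / 2 \<le> B - A" using AeB by linarith
  have "gap_rate n b - 1 = 2 * A / (B - A)"
    using AB unfolding gap_rate_def A_def[symmetric] B_def[symmetric] by (simp add: field_simps)
  also have "\<dots> \<le> 2 * (e * B) / (B / 2)"
    using AeB half B b by (intro frac_le) (auto simp: A_def e_def)
  also have "\<dots> = 4 * e" using B by simp
  finally show ?thesis by (simp add: e_def)
qed

lemma powr_half_nat:
  assumes "0 < x"
  shows "x powr (real n / 2) = sqrt x ^ n"
proof -
  have "x powr (real n / 2) = (x powr (1 / 2)) powr real n"
    by (simp add: powr_powr)
  then show ?thesis
    using assms by (simp add: powr_half_sqrt powr_realpow)
qed

lemma asymp_equiv_linearI:
  fixes f :: "real \<Rightarrow> real"
  assumes "((\<lambda>t. f t / t) \<longlongrightarrow> c) at_top" "c \<noteq> 0"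
  shows "f \<sim>[at_top] (\<lambda>t. c * t)"
proof (rule asymp_equivI')
  have "((\<lambda>t. f t / t / c) \<longlongrightarrow> c / c) at_top"
    using assms by (intro tendsto_divide tendsto_const)
  then show "((\<lambda>t. f t / (c * t)) \<longlongrightarrow> 1) at_top"
    using assms(2) by (simp add: mult.commute)
qed

text \<open>The two-ring configuration is one solution, and uniqueness forces every other solution
  to have the same radii and angles.\<close>

lemma two_ring_solution_and_radii:
  fixes p :: "nat \<Rightarrow> real^2"
  assumes m: "\<forall>j\<in>{1..2*n}. m j = m0" "m0 \<in> {1, -1}" and n: "0 < n"
    and a: "0 < a1" "0 < a2"
    and p: "\<forall>j\<in>{1..n}. p j = a1 *\<^sub>R unit_vec (ring_angle n \<theta>0 j) \<and>
              p (n + j) = a2 *\<^sub>R unit_vec (ring_angle n \<theta>0 j)"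
    and init: "\<rho>1 0 = a1\<^sup>2" "\<rho>2 0 = a2\<^sup>2"
    and pos: "\<And>t. 0 \<le> t \<Longrightarrow> 0 < \<rho>1 t" "\<And>t. 0 \<le> t \<Longrightarrow> \<rho>1 t < \<rho>2 t"
    and d1: "\<And>t. 0 \<le> t \<Longrightarrow> (\<rho>1 has_real_derivative
        2 * sqrt (\<rho>1 t) * ring_speed n (sqrt (\<rho>1 t)) (sqrt (\<rho>2 t))) (at t)"
    and d2: "\<And>t. 0 \<le> t \<Longrightarrow> (\<rho>2 has_real_derivative
        2 * sqrt (\<rho>2 t) * ring_speed n (sqrt (\<rho>2 t)) (sqrt (\<rho>1 t))) (at t)"
  shows "\<exists>x. vortex_solution (2 * n) m p x"
    and "\<And>t. 0 \<le> t \<Longrightarrow> 0 \<le> \<rho>1 t \<and> 0 \<le> \<rho>2 t"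
    and "\<And>x j t. vortex_solution (2 * n) m p x \<Longrightarrow> j \<in> {1..n} \<Longrightarrow> 0 \<le> t \<Longrightarrow>
        x j t = sqrt (\<rho>1 t) *\<^sub>R unit_vec (ring_angle n \<theta>0 j) \<and>
        x (n + j) t = sqrt (\<rho>2 t) *\<^sub>R unit_vec (ring_angle n \<theta>0 j)"
proof -
  have cont: "continuous_on {0..} \<rho>1" "continuous_on {0..} \<rho>2"
    using DERIV_isCont[OF d1] DERIV_isCont[OF d2]
    by (auto intro!: continuous_at_imp_continuous_on)
  have sol: "vortex_solution (2 * n) m p (two_rings n \<theta>0 \<rho>1 \<rho>2)"
    using p a init
    by (intro vortex_solution_two_rings[OF m n pos cont d1 d2]) auto
  then show "\<exists>x. vortex_solution (2 * n) m p x" by blast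
  show "0 \<le> \<rho>1 t \<and> 0 \<le> \<rho>2 t" if "0 \<le> t" for t
    using pos[OF that] by simp
  show "x j t = sqrt (\<rho>1 t) *\<^sub>R unit_vec (ring_angle n \<theta>0 j) \<and>
      x (n + j) t = sqrt (\<rho>2 t) *\<^sub>R unit_vec (ring_angle n \<theta>0 j)"
    if x: "vortex_solution (2 * n) m p x" and j: "j \<in> {1..n}" and t: "0 \<le> t" for x j t
    using vortex_solution_unique[OF x sol _ t, of j] vortex_solution_unique[OF x sol _ t, of "n + j"] j
    by (simp add: two_rings_simps)
qed

text \<open>The growth constants are functions of \<open>n\<close> chosen before all initial data,
  so the approximations for large \<open>n\<close> can be stated as differences tending to 0. The
  form of the solution is expressed by existence together with a claim about every solution.\<close>

theorem proposition4p1: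
  "\<exists>\<alpha> \<beta> :: nat \<Rightarrow> real.
     (\<forall>n\<ge>3. 0 < \<alpha> n \<and> \<alpha> n < \<beta> n \<and> \<alpha> n + \<beta> n = 8 * real n - 4 \<and>
        \<beta> n - \<alpha> n = 4 * real n *
          ((\<beta> n powr (real n / 2) + \<alpha> n powr (real n / 2)) /
           (\<beta> n powr (real n / 2) - \<alpha> n powr (real n / 2)))) \<and>
     (\<lambda>n. \<alpha> n - (2 * real n - 2)) \<longlonglongrightarrow> 0 \<and>
     (\<lambda>n. \<beta> n - (6 * real n - 2)) \<longlonglongrightarrow> 0 \<and>
     (\<forall>(n::nat) (m0::int) (m::nat \<Rightarrow> int) (\<theta>0::real) (a1::real) (a2::real) (C1::real) (C2::real)
        (p::nat \<Rightarrow> real^2).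
        2 \<le> n \<longrightarrow> m0 \<in> {1, -1} \<longrightarrow> (\<forall>j\<in>{1..2*n}. m j = m0) \<longrightarrow>
        0 \<le> \<theta>0 \<longrightarrow> \<theta>0 < 2 * pi \<longrightarrow> 0 < a1 \<longrightarrow> a1 < a2 \<longrightarrow>
        C1 = (a1\<^sup>2 + a2\<^sup>2) / 2 \<longrightarrow> C2 = (a2\<^sup>2 - a1\<^sup>2) / 2 \<longrightarrow>
        (\<forall>j\<in>{1..n}. p j = a1 *\<^sub>R unit_vec (ring_angle n \<theta>0 j) \<and>
                    p (n + j) = a2 *\<^sub>R unit_vec (ring_angle n \<theta>0 j)) \<longrightarrow>
        (\<exists>x. vortex_solution (2 * n) m p x) \<and>
        (\<exists>\<rho>1 \<rho>2 :: real \<Rightarrow> real.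
           (\<forall>t\<ge>0. 0 \<le> \<rho>1 t \<and> 0 \<le> \<rho>2 t) \<and>
           (\<forall>x. vortex_solution (2 * n) m p x \<longrightarrow>
              (\<forall>j\<in>{1..n}. \<forall>t\<ge>0.
                 x j t = sqrt (\<rho>1 t) *\<^sub>R unit_vec (ring_angle n \<theta>0 j) \<and>
                 x (n + j) t = sqrt (\<rho>2 t) *\<^sub>R unit_vec (ring_angle n \<theta>0 j))) \<and>
           (n = 2 \<longrightarrow>
              (\<forall>t\<ge>0. \<rho>1 t = C1 + 6 * t - sqrt (C2\<^sup>2 + 8 * C1 * t + 24 * t\<^sup>2) \<and>
                     \<rho>2 t = C1 + 6 * t + sqrt (C2\<^sup>2 + 8 * C1 * t + 24 * t\<^sup>2))) \<and>
           (n \<ge> 3 \<longrightarrow>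
              \<rho>1 \<sim>[at_top] (\<lambda>t. \<alpha> n * t) \<and> \<rho>2 \<sim>[at_top] (\<lambda>t. \<beta> n * t))))"
proof -
  have "\<forall>n. \<exists>b. 2 \<le> n \<longrightarrow> b \<in> {1/2<..<1} \<and> gap_drift n b = 0"
    using gap_equilibrium_exists by blast
  then obtain b where b: "\<And>n. 2 \<le> n \<Longrightarrow> b n \<in> {1/2<..<1}"
    "\<And>n. 2 \<le> n \<Longrightarrow> gap_drift n (b n) = 0"
    by metis
  \<comment> \<open>These have sum \<open>8 * n - 4\<close> and normalised gap \<open>b n\<close>,
    so the required relation for their difference is the equilibrium equation for
    \<open>b n\<close>.\<close>
  define \<alpha> \<beta> where "\<alpha> = (\<lambda>n. (4 * real n - 2) * (1 - b n))"
    and "\<beta> = (\<lambda>n. (4 * real n - 2) * (1 + b n))"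
  have gap: "(8 * real n - 4) * b n = 4 * real n * gap_rate n (b n)" if "2 \<le> n" for n
    using b(2)[OF that] by (simp add: gap_drift_def)
  have \<alpha>\<beta>: "0 < \<alpha> n" "\<alpha> n < \<beta> n" if "2 \<le> n" for n
    using b(1)[OF that] that by (simp_all add: \<alpha>_def \<beta>_def)
  have sum: "\<alpha> n + \<beta> n = 8 * real n - 4" for n
    by (simp add: \<alpha>_def \<beta>_def algebra_simps)
  have diff: "\<beta> n - \<alpha> n = 4 * real n *
          ((\<beta> n powr (real n / 2) + \<alpha> n powr (real n / 2)) /
           (\<beta> n powr (real n / 2) - \<alpha> n powr (real n / 2)))" if n: "2 \<le> n" for n
  proof -
    have "0 < \<alpha> n" "0 < \<beta> n" using \<alpha>\<beta>[OF n] by auto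
    then have powr: "\<alpha> n powr (real n / 2) = sqrt (4 * real n - 2) ^ n * sqrt (1 - b n) ^ n"
      "\<beta> n powr (real n / 2) = sqrt (4 * real n - 2) ^ n * sqrt (1 + b n) ^ n"
      by (simp_all only: powr_half_nat)
         (simp_all add: \<alpha>_def \<beta>_def real_sqrt_mult power_mult_distrib)
    have "sqrt (4 * real n - 2) ^ n \<noteq> 0" using n by simp
    then have "(\<beta> n powr (real n / 2) + \<alpha> n powr (real n / 2)) /
           (\<beta> n powr (real n / 2) - \<alpha> n powr (real n / 2)) = gap_rate n (b n)"
      unfolding powr gap_rate_def
      by (simp flip: distrib_left right_diff_distrib)
    moreover have "\<beta> n - \<alpha> n = (8 * real n - 4) * b n"
      by (simp add: \<alpha>_def \<beta>_def algebra_simps)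
    ultimately show ?thesis using gap[OF n] by simp
  qed
  \<comment> \<open>The equilibrium equation replaces \<open>(4 * n - 2) * b n\<close> by
    \<open>2 * n * gap_rate n (b n)\<close>; the remainder is geometrically small up to the factor
    \<open>n\<close>.\<close>
  have excess: "\<beta> n - (6 * real n - 2) = 2 * real n * (gap_rate n (b n) - 1)" if "2 \<le> n" for n
    using gap[OF that] by (simp add: \<beta>_def algebra_simps)
  have "norm (1 / sqrt 3) < 1" by simp
  from tendsto_mult[OF tendsto_const powser_times_n_limit_0[OF this], of 8]
  have "(\<lambda>n. 8 * (real n * (1 / sqrt 3) ^ n)) \<longlonglongrightarrow> 0" by simp
  moreover have "eventually (\<lambda>n. norm (\<beta> n - (6 * real n - 2)) \<le> 8 * (real n * (1 / sqrt 3) ^ n)) sequentially"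
    using eventually_ge_at_top[of 2]
  proof eventually_elim
    case (elim n)
    have "b n \<in> {1/2<..<1}" by (rule b(1)[OF elim])
    then have "0 \<le> gap_rate n (b n) - 1" "gap_rate n (b n) - 1 \<le> 4 * (1 / sqrt 3) ^ n"
      using gap_rate_ge_1[of n "b n"] gap_rate_equilibrium_bound[of n "b n"] elim by auto
    then have "0 \<le> 2 * real n * (gap_rate n (b n) - 1)"
      "2 * real n * (gap_rate n (b n) - 1) \<le> 2 * real n * (4 * (1 / sqrt 3) ^ n)"
      by (intro mult_nonneg_nonneg mult_left_mono; simp)+
    then show ?case
      unfolding excess[OF elim] by simp
  qed
  ultimately have \<beta>_lim: "(\<lambda>n. \<beta> n - (6 * real n - 2)) \<longlonglongrightarrow> 0"
    by (rule Lim_null_comparison[rotated])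
  \<comment> \<open>The sum of the constants is exact, so the two errors are opposite.\<close>
  have "(\<lambda>n. \<alpha> n - (2 * real n - 2)) = (\<lambda>n. - (\<beta> n - (6 * real n - 2)))"
  proof
    show "\<alpha> n - (2 * real n - 2) = - (\<beta> n - (6 * real n - 2))" for n
      using sum[of n] by linarith
  qed
  then have \<alpha>_lim: "(\<lambda>n. \<alpha> n - (2 * real n - 2)) \<longlonglongrightarrow> 0"
    using tendsto_minus[OF \<beta>_lim] by (simp only: minus_zero)
  show ?thesis
  proof (rule exI[of _ \<alpha>], rule exI[of _ \<beta>], intro conjI allI impI \<alpha>_lim \<beta>_lim)
    fix n :: nat assume "3 \<le> n"
    then have n: "2 \<le> n" by simp
    show "0 < \<alpha> n" "\<alpha> n < \<beta> n" by (rule \<alpha>\<beta>[OF n])+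
    show "\<alpha> n + \<beta> n = 8 * real n - 4" by (rule sum)
    show "\<beta> n - \<alpha> n = 4 * real n *
          ((\<beta> n powr (real n / 2) + \<alpha> n powr (real n / 2)) /
           (\<beta> n powr (real n / 2) - \<alpha> n powr (real n / 2)))" by (rule diff[OF n])
  next
    fix n :: nat and m0 :: int and m :: "nat \<Rightarrow> int" and \<theta>0 a1 a2 C1 C2 :: real
      and p :: "nat \<Rightarrow> real^2"
    assume n: "2 \<le> n" and m: "m0 \<in> {1, -1}" "\<forall>j\<in>{1..2*n}. m j = m0"
      and a: "0 < a1" "a1 < a2"
      and C1: "C1 = (a1\<^sup>2 + a2\<^sup>2) / 2" and C2: "C2 = (a2\<^sup>2 - a1\<^sup>2) / 2"
      and p: "\<forall>j\<in>{1..n}. p j = a1 *\<^sub>R unit_vec (ring_angle n \<theta>0 j) \<and>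
                    p (n + j) = a2 *\<^sub>R unit_vec (ring_angle n \<theta>0 j)"
    have n0: "0 < n" and a2: "0 < a2" using n a by auto
    have "a1\<^sup>2 < a2\<^sup>2" using a by (intro power_strict_mono) auto
    then have C: "0 < C2" "C2 < C1" using a by (simp_all add: C1 C2)
    have C12: "C1 - C2 = a1\<^sup>2" "C1 + C2 = a2\<^sup>2" by (simp_all add: C1 C2 field_simps)
    note solve = two_ring_solution_and_radii[OF m(2,1) n0 a(1) a2 p]
    have "(\<exists>x. vortex_solution (2 * n) m p x) \<and>
        (\<exists>\<rho>1 \<rho>2 :: real \<Rightarrow> real.
           (\<forall>t\<ge>0. 0 \<le> \<rho>1 t \<and> 0 \<le> \<rho>2 t) \<and>
           (\<forall>x. vortex_solution (2 * n) m p x \<longrightarrow>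
              (\<forall>j\<in>{1..n}. \<forall>t\<ge>0.
                 x j t = sqrt (\<rho>1 t) *\<^sub>R unit_vec (ring_angle n \<theta>0 j) \<and>
                 x (n + j) t = sqrt (\<rho>2 t) *\<^sub>R unit_vec (ring_angle n \<theta>0 j))) \<and>
           (n = 2 \<longrightarrow>
              (\<forall>t\<ge>0. \<rho>1 t = C1 + 6 * t - sqrt (C2\<^sup>2 + 8 * C1 * t + 24 * t\<^sup>2) \<and>
                     \<rho>2 t = C1 + 6 * t + sqrt (C2\<^sup>2 + 8 * C1 * t + 24 * t\<^sup>2))) \<and>
           (n \<ge> 3 \<longrightarrow>
              \<rho>1 \<sim>[at_top] (\<lambda>t. \<alpha> n * t) \<and> \<rho>2 \<sim>[at_top] (\<lambda>t. \<beta> n * t)))"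
    \<comment> \<open>The closed form serves \<open>n = 2\<close>; for larger \<open>n\<close> the
      radii come from the convergent flow of the normalised gap.\<close>
    proof (cases "n = 2")
      case True
      define \<rho>1 \<rho>2 where
        "\<rho>1 = (\<lambda>t. C1 + 6 * t - sqrt (C2\<^sup>2 + 8 * C1 * t + 24 * t\<^sup>2))" and
        "\<rho>2 = (\<lambda>t. C1 + 6 * t + sqrt (C2\<^sup>2 + 8 * C1 * t + 24 * t\<^sup>2))"
      have init: "\<rho>1 0 = a1\<^sup>2" "\<rho>2 0 = a2\<^sup>2"
        using C C12 by (simp_all add: \<rho>1_def \<rho>2_def)
      have \<rho>: "0 < \<rho>1 t" "\<rho>1 t < \<rho>2 t"
        "(\<rho>1 has_real_derivative
            2 * sqrt (\<rho>1 t) * ring_speed n (sqrt (\<rho>1 t)) (sqrt (\<rho>2 t))) (at t)"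
        "(\<rho>2 has_real_derivative
            2 * sqrt (\<rho>2 t) * ring_speed n (sqrt (\<rho>2 t)) (sqrt (\<rho>1 t))) (at t)"
        if "0 \<le> t" for t
        unfolding \<rho>1_def \<rho>2_def True by (rule two_ring_radii_2[OF C that])+
      note s = solve[OF init \<rho>]
      show ?thesis
        using s True
        by (intro conjI exI[of _ \<rho>1] exI[of _ \<rho>2]) (auto simp: \<rho>1_def \<rho>2_def)
    next
      case False
      have "b n \<in> {0<..<1}" using b(1)[OF n] by auto
      then obtain \<rho>1 \<rho>2 where \<rho>: "\<rho>1 0 = C1 - C2" "\<rho>2 0 = C1 + C2"
        "\<And>t. 0 \<le> t \<Longrightarrow> 0 < \<rho>1 t" "\<And>t. 0 \<le> t \<Longrightarrow> \<rho>1 t < \<rho>2 t"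
        "\<And>t. 0 \<le> t \<Longrightarrow> (\<rho>1 has_real_derivative
            2 * sqrt (\<rho>1 t) * ring_speed n (sqrt (\<rho>1 t)) (sqrt (\<rho>2 t))) (at t)"
        "\<And>t. 0 \<le> t \<Longrightarrow> (\<rho>2 has_real_derivative
            2 * sqrt (\<rho>2 t) * ring_speed n (sqrt (\<rho>2 t)) (sqrt (\<rho>1 t))) (at t)"
        "((\<lambda>t. \<rho>1 t / t) \<longlongrightarrow> \<alpha> n) at_top" "((\<lambda>t. \<rho>2 t / t) \<longlongrightarrow> \<beta> n) at_top"
        unfolding \<alpha>_def \<beta>_def using two_ring_radii_exist[OF n C _ b(2)[OF n]] by blast
      have "\<rho>1 \<sim>[at_top] (\<lambda>t. \<alpha> n * t)" "\<rho>2 \<sim>[at_top] (\<lambda>t. \<beta> n * t)"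
        using \<alpha>\<beta>[OF n] by (auto intro!: asymp_equiv_linearI \<rho>(7,8))
      moreover note s = solve[OF \<rho>(1)[unfolded C12] \<rho>(2)[unfolded C12] \<rho>(3-6)]
      ultimately show ?thesis
        using False by (intro conjI exI[of _ \<rho>1] exI[of _ \<rho>2]) auto
    qed
    then show "\<exists>x. vortex_solution (2 * n) m p x"
      and "\<exists>\<rho>1 \<rho>2 :: real \<Rightarrow> real.
           (\<forall>t\<ge>0. 0 \<le> \<rho>1 t \<and> 0 \<le> \<rho>2 t) \<and>
           (\<forall>x. vortex_solution (2 * n) m p x \<longrightarrow>
              (\<forall>j\<in>{1..n}. \<forall>t\<ge>0.
                 x j t = sqrt (\<rho>1 t) *\<^sub>R unit_vec (ring_angle n \<theta>0 j) \<and>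
                 x (n + j) t = sqrt (\<rho>2 t) *\<^sub>R unit_vec (ring_angle n \<theta>0 j))) \<and>
           (n = 2 \<longrightarrow>
              (\<forall>t\<ge>0. \<rho>1 t = C1 + 6 * t - sqrt (C2\<^sup>2 + 8 * C1 * t + 24 * t\<^sup>2) \<and>
                     \<rho>2 t = C1 + 6 * t + sqrt (C2\<^sup>2 + 8 * C1 * t + 24 * t\<^sup>2))) \<and>
           (n \<ge> 3 \<longrightarrow>
              \<rho>1 \<sim>[at_top] (\<lambda>t. \<alpha> n * t) \<and> \<rho>2 \<sim>[at_top] (\<lambda>t. \<beta> n * t))"
      by (rule conjunct1, rule conjunct2)
  qed
qed

end
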